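(* Let $d\ge 1$ and $n\ge 1$ be natural numbers, let $Z_d$ be a standard normal random vector in $\mathbb{R}^d$, and let $X_1,\dots,X_n$ be any independent spherically invariant random vectors in $\mathbb{R}^d$, which are also independent of $Z_d$. Then $$\mathsf{P}(\|X_1+\dots+X_n\|>u)<\frac{2e^3}{9}\,\mathsf{P}\Big(\sqrt{\|X_1\|^2+\dots+\|X_n\|^2}\;\|Z_d\|>u\Big)$$ for all real $u$.
   Context: $\|x\|:=\sqrt{x\cdot x}$ is the Euclidean norm on $\mathbb{R}^d$, where $x\cdot y$ is the standard inner product. A random vector $X$ in $\mathbb{R}^d$ is spherically invariant if its distribution is invariant under all orthogonal transformations of $\mathbb{R}^d$; equivalently, for $U$ uniformly distributed on the unit sphere $S^{d-1}$ in $\mathbb{R}^d$, the conditional distribution of $X$ given $\|X\|=r$ is that of $rU$.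
   Formalization: For u ≥ 0 it is additionally assumed that at least one X_i is not almost surely zero; if all X_i = 0 almost surely and u ≥ 0, both probabilities are 0 and the strict inequality fails. *)

theory Defs
  imports "HOL-Probability.Probability"
begin

definition spherically_invariant :: "'w measure \<Rightarrow> ('w \<Rightarrow> real ^ 'd) \<Rightarrow> bool" where
  "spherically_invariant M X \<longleftrightarrow>
     X \<in> borel_measurable M \<and>
     (\<forall>T. orthogonal_transformation T \<longrightarrow>
        distr M borel (\<lambda>\<omega>. T (X \<omega>)) = distr M borel X)"

definition standard_normal_vector :: "'w measure \<Rightarrow> ('w \<Rightarrow> real ^ 'd) \<Rightarrow> bool" where
  "standard_normal_vector M Z \<longleftrightarrow>
     prob_space.indep_vars M (\<lambda>_. borel) (\<lambda>i \<omega>. Z \<omega> $ i) UNIV \<and>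
     (\<forall>i. distributed M lborel (\<lambda>\<omega>. Z \<omega> $ i) std_normal_density)"

end

theory Submission imports Defs "HOL-Real_Asymp.Real_Asymp" begin

text \<open>
  Every \<^term>\<open>X i\<close> has the same law as \<^term>\<open>- X i\<close>, so by independence
  the law of \<open>\<Sum> X i\<close> does not change when any set of the summands is negated. Averaging over all
  such sets, \<open>P(norm (\<Sum> X i) > u)\<close> is the expected proportion of sign patterns for which the signed
  sum of the vectors \<open>X i \<omega>\<close> is longer than \<open>u\<close>. It therefore suffices to treat signed
  sums of fixed vectors \<open>x i\<close>, and to compare their tail, with \<open>a = sqrt (\<Sum> (norm (x i))\<^sup>2)\<close>,
  to that of \<open>a * \<bar>\<xi>\<bar>\<close> for a real standard normal \<open>\<xi>\<close>: any coordinate of \<open>Z\<close> is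
  such a \<open>\<xi>\<close> and is at most \<open>norm Z\<close> in absolute value.

  The comparison for fixed vectors first replaces tails by moments. If \<open>f\<close> is even with a convex second
  derivative, then the mean of \<open>f (norm S)\<close> over the signed sums \<open>S\<close> is at most the mean of
  \<open>f (a * \<xi>)\<close> (\<open>signed_sum_gauss_domination\<close>). The useful form of the condition on \<open>f\<close> is that
  \<open>f (s + sqrt w) + f (s - sqrt w)\<close> is convex in \<open>w\<close> for every \<open>s\<close> (\<open>spread_convex\<close>). It does
  three things. At \<open>s = 0\<close> it says that for given lengths of \<open>y\<close> and \<open>x\<close> the mean of
  \<open>f (norm (y \<plusminus> x))\<close> is largest when \<open>x\<close> and \<open>y\<close> are parallel, which removes the
  dimension. By Jensen's inequality applied to \<open>w = r\<^sup>2 * \<xi>\<^sup>2\<close>, it lets a random sign of size \<open>r\<close> be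
  replaced by \<open>r * \<xi>\<close>. Finally it survives averaging over shifts, so the argument
  can be repeated for the next summand.

  To return from moments to tails, let \<open>a = 1\<close> and let \<open>Q\<close> be the tail function and \<open>\<phi>\<close> the density
  of \<open>\<xi>\<close>; consider the level \<open>v\<close>. For \<open>v\<^sup>2 \<ge> 3\<close>, Markov's inequality is applied to the
  function \<open>f(s) = (\<bar>s\<bar> - t)\<^sup>3\<close>, set to zero for \<open>\<bar>s\<bar> \<le> t\<close>. The log-concave function \<open>Q\<close> lies below
  its exponential tangent at \<open>v\<close>, with rate \<open>c = \<phi>(v) / Q(v)\<close>; for a truly exponential tail the
  Markov bound is \<open>6 e\<^sup>b / b\<^sup>3\<close> times the tail, with \<open>b = c * (v - t)\<close>, and its minimum,
  at \<open>b = 3\<close>, is the constant \<open>2 e\<^sup>3 / 9\<close>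
  (\<open>truncated_cubic_moment_bound\<close>). The choice \<open>t = v - 3 / c\<close> is nonnegative because \<open>c \<ge> v\<close>.
  For \<open>1 \<le> v\<^sup>2 \<le> 3\<close> Chebyshev's inequality and a lower bound for \<open>Q\<close> are enough
  (\<open>moderate_deviation_tail\<close>), and for \<open>v \<le> 1\<close> the right-hand side exceeds \<open>1\<close>.
\<close>

section \<open>The standard normal law on the line\<close>

definition std_normal :: "real measure" where
  "std_normal = density lborel (\<lambda>z. ennreal (std_normal_density z))"

lemma sets_std_normal [simp, measurable_cong]: "sets std_normal = sets borel"
  by (simp add: std_normal_def)

lemma space_std_normal [simp]: "space std_normal = UNIV"
  by (simp add: std_normal_def)

lemma prob_space_std_normal: "prob_space std_normal"
  unfolding std_normal_def by (rule prob_space_normal_density) simp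

interpretation std_normal: prob_space std_normal
  by (rule prob_space_std_normal)

lemma measure_std_normal_UNIV [simp]: "measure std_normal UNIV = 1"
  using std_normal.prob_space by simp

lemma integral_std_normal:
  fixes f :: "real \<Rightarrow> real"
  assumes [measurable]: "f \<in> borel_measurable borel"
  shows "(\<integral>z. f z \<partial>std_normal) = (\<integral>z. std_normal_density z * f z \<partial>lborel)"
  unfolding std_normal_def by (subst integral_density) auto

lemma integrable_std_normal:
  fixes f :: "real \<Rightarrow> real"
  assumes [measurable]: "f \<in> borel_measurable borel"
  shows "integrable std_normal f \<longleftrightarrow> integrable lborel (\<lambda>z. std_normal_density z * f z)"
  unfolding std_normal_def by (subst integrable_density) auto

lemma integrable_std_normal_abs_power: "integrable std_normal (\<lambda>z. \<bar>z\<bar> ^ k)"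
  by (simp add: integrable_std_normal integrable_std_normal_moment_abs)

lemma std_normal_second_moment:
  "integrable std_normal (\<lambda>z. z\<^sup>2)" "(\<integral>z. z\<^sup>2 \<partial>std_normal) = 1"
  using integrable_std_normal_abs_power[of 2] integral_std_normal_moment_even[of 1]
  by (simp_all add: integral_std_normal)

lemma distributed_std_normal: "distributed std_normal lborel (\<lambda>z. z) std_normal_density"
proof -
  have "distr std_normal lborel (\<lambda>z. z) = std_normal"
    by (intro distr_id2) simp
  then show ?thesis
    by (simp add: distributed_def std_normal_def)
qed

lemma std_normal_uminus: "distr std_normal borel uminus = std_normal"
proof -
  have "distributed std_normal lborel (\<lambda>z. 0 + (-1) * z) (normal_density (0 + (-1) * 0) (\<bar>-1\<bar> * 1))"
    by (rule std_normal.normal_density_affine[OF distributed_std_normal]) auto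
  then have "distr std_normal lborel uminus = std_normal"
    by (simp add: distributed_def std_normal_def)
  moreover have "distr std_normal lborel uminus = distr std_normal borel uminus"
    by (rule distr_cong) auto
  ultimately show ?thesis by simp
qed

lemma integral_std_normal_reflect:
  fixes f :: "real \<Rightarrow> real"
  assumes [measurable]: "f \<in> borel_measurable borel"
  shows "(\<integral>z. f (- z) \<partial>std_normal) = (\<integral>z. f z \<partial>std_normal)"
proof -
  have "(\<integral>z. f z \<partial>std_normal) = (\<integral>z. f z \<partial>distr std_normal borel uminus)"
    by (simp add: std_normal_uminus)
  also have "\<dots> = (\<integral>z. f (- z) \<partial>std_normal)"
    by (rule integral_distr) auto
  finally show ?thesis by simp
qed

lemma distr_scaled_std_normal:
  assumes "r > 0"
  shows "distr std_normal borel ((*) r) = density lborel (\<lambda>z. ennreal (normal_density 0 r z))"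
proof -
  have "distributed std_normal lborel (\<lambda>z. 0 + r * z) (normal_density (0 + r * 0) (\<bar>r\<bar> * 1))"
    by (rule std_normal.normal_density_affine[OF distributed_std_normal]) (use assms in auto)
  moreover have "distr std_normal lborel ((*) r) = distr std_normal borel ((*) r)"
    by (rule distr_cong) auto
  ultimately show ?thesis
    using assms by (simp add: distributed_def)
qed

text \<open>
  The sum of independent centred normal variables is centred normal, in the form needed to compose two
  Gaussian averages. Scales equal to zero are included because some of the summands may vanish.
\<close>
lemma std_normal_convolution:
  assumes "r \<ge> 0" "q \<ge> 0"
  shows "distr (std_normal \<Otimes>\<^sub>M std_normal) borel (\<lambda>(y, z). r * y + q * z)
       = distr std_normal borel ((*) (sqrt (r\<^sup>2 + q\<^sup>2)))"
proof -
  let ?P = "std_normal \<Otimes>\<^sub>M std_normal"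
  interpret P: pair_prob_space std_normal std_normal ..
  have law_fst: "distr ?P borel (\<lambda>x. g (fst x)) = distr std_normal borel g"
    and law_snd: "distr ?P borel (\<lambda>x. g (snd x)) = distr std_normal borel g"
    if [measurable]: "g \<in> borel_measurable borel" for g :: "real \<Rightarrow> real"
  proof -
    have "distr ?P borel (\<lambda>x. g (fst x)) = distr (distr ?P std_normal fst) borel g"
      by (subst distr_distr) (auto simp: comp_def)
    then show "distr ?P borel (\<lambda>x. g (fst x)) = distr std_normal borel g"
      by (simp add: std_normal.distr_pair_fst)
    have "distr ?P borel (\<lambda>x. g (snd x)) = distr (distr ?P (std_normal \<Otimes>\<^sub>M std_normal) (\<lambda>(x, y). (y, x))) borel (\<lambda>x. g (fst x))"
      by (subst distr_distr) (auto simp: comp_def case_prod_beta')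
    also have "\<dots> = distr ?P borel (\<lambda>x. g (fst x))"
      by (subst P.distr_pair_swap[symmetric]) simp
    finally show "distr ?P borel (\<lambda>x. g (snd x)) = distr std_normal borel g"
      using \<open>distr ?P borel (\<lambda>x. g (fst x)) = distr std_normal borel g\<close> by simp
  qed
  consider "r = 0" | "q = 0" | "r > 0" "q > 0"
    using assms by fastforce
  then show ?thesis
  proof cases
    case 1
    then show ?thesis
      using law_snd[of "(*) q"] assms by (simp add: case_prod_beta')
  next
    case 2
    then show ?thesis
      using law_fst[of "(*) r"] assms by (simp add: case_prod_beta')
  next
    case 3
    let ?D = "\<lambda>s. distr std_normal borel ((*) s)"
    have D: "prob_space (?D s)" for s
      by (rule std_normal.prob_space_distr) simp
    have fin: "finite_measure (?D s)" for s
      using D by (simp add: prob_space.finite_measure)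
    have "distr ?P borel (\<lambda>(y, z). r * y + q * z)
        = distr (distr ?P (borel \<Otimes>\<^sub>M borel) (\<lambda>(y, z). (r * y, q * z))) borel (\<lambda>(y, z). y + z)"
      by (subst distr_distr) (auto simp: comp_def case_prod_beta')
    also have "distr ?P (borel \<Otimes>\<^sub>M borel) (\<lambda>(y, z). (r * y, q * z)) = ?D r \<Otimes>\<^sub>M ?D q"
      by (rule pair_measure_distr[symmetric]) (auto simp: D prob_space_imp_sigma_finite)
    also have "distr (?D r \<Otimes>\<^sub>M ?D q) borel (\<lambda>(y, z). y + z) = convolution (?D r) (?D q)"
      by (simp add: convolution_def)
    also have "\<dots> = density lborel (\<lambda>x. \<integral>\<^sup>+y. ennreal (normal_density 0 r (x - y)) * ennreal (normal_density 0 q y) \<partial>lborel)"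
      using 3 fin[of r] fin[of q]
      by (simp add: distr_scaled_std_normal) (rule convolution_density, auto)
    also have "\<dots> = density lborel (normal_density 0 (sqrt (r\<^sup>2 + q\<^sup>2)))"
      using conv_normal_density_zero_mean[OF 3] by (simp add: ennreal_mult'[symmetric])
    also have "\<dots> = ?D (sqrt (r\<^sup>2 + q\<^sup>2))"
      using 3 by (intro distr_scaled_std_normal[symmetric]) (simp add: sum_power2_gt_zero_iff)
    finally show ?thesis .
  qed
qed

section \<open>Functions for which spreading the argument increases the mean\<close>

text \<open>
  The bound only secures integrability against normal laws. Writing it with a power of \<open>1 + \<bar>s\<bar>\<close>
  makes it submultiplicative, hence stable under Gaussian averaging.
\<close>
definition cubic_growth :: "(real \<Rightarrow> real) \<Rightarrow> bool" where
  "cubic_growth f \<longleftrightarrow>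
     f \<in> borel_measurable borel \<and> (\<exists>K\<ge>0. \<forall>s. \<bar>f s\<bar> \<le> K * (1 + \<bar>s\<bar>) ^ 3)"

text \<open>
  Among even functions with two derivatives, those with a convex second derivative have this property
  (\<open>spread_convex_of_convex_second_deriv\<close>). The formulation without derivatives is
  the one that visibly passes to averages over shifts and that Jensen's inequality can use directly.
\<close>
definition spread_convex :: "(real \<Rightarrow> real) \<Rightarrow> bool" where
  "spread_convex f \<longleftrightarrow>
     (\<forall>s. f (- s) = f s) \<and> (\<forall>s. convex_on {0..} (\<lambda>w. f (s + sqrt w) + f (s - sqrt w)))"

definition gauss_smooth :: "real \<Rightarrow> (real \<Rightarrow> real) \<Rightarrow> real \<Rightarrow> real" where
  "gauss_smooth r f s = (\<integral>z. f (s + r * z) \<partial>std_normal)"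

lemma integrable_std_normal_cubic: "integrable std_normal (\<lambda>z. (1 + c * \<bar>z\<bar>) ^ 3)"
proof -
  have "(1 + c * \<bar>z\<bar>) ^ 3 = 1 + 3 * c * \<bar>z\<bar> ^ 1 + 3 * c\<^sup>2 * \<bar>z\<bar> ^ 2 + c ^ 3 * \<bar>z\<bar> ^ 3" for z :: real
    by (simp add: power2_eq_square power3_eq_cube algebra_simps)
  then show ?thesis
    using integrable_std_normal_abs_power[of 1] integrable_std_normal_abs_power[of 2]
      integrable_std_normal_abs_power[of 3] by simp
qed

lemma cubic_growth_measurable [measurable_dest]:
  "cubic_growth f \<Longrightarrow> f \<in> borel_measurable borel"
  by (simp add: cubic_growth_def)

lemma cubic_growth_shift_bound:
  fixes s r z :: real
  assumes "K \<ge> 0" "\<And>s. \<bar>f s\<bar> \<le> K * (1 + \<bar>s\<bar>) ^ 3"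
  shows "\<bar>f (s + r * z)\<bar> \<le> K * (1 + \<bar>s\<bar>) ^ 3 * (1 + \<bar>r\<bar> * \<bar>z\<bar>) ^ 3"
proof -
  have "1 + \<bar>s + r * z\<bar> \<le> 1 + \<bar>s\<bar> + \<bar>r\<bar> * \<bar>z\<bar>"
    using abs_triangle_ineq[of s "r * z"] by (simp add: abs_mult)
  also have "\<dots> \<le> (1 + \<bar>s\<bar>) * (1 + \<bar>r\<bar> * \<bar>z\<bar>)"
    by (simp add: algebra_simps)
  finally have "(1 + \<bar>s + r * z\<bar>) ^ 3 \<le> ((1 + \<bar>s\<bar>) * (1 + \<bar>r\<bar> * \<bar>z\<bar>)) ^ 3"
    by (intro power_mono) auto
  then have "K * (1 + \<bar>s + r * z\<bar>) ^ 3 \<le> K * ((1 + \<bar>s\<bar>) * (1 + \<bar>r\<bar> * \<bar>z\<bar>)) ^ 3"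
    using assms(1) by (rule mult_left_mono)
  then show ?thesis
    using assms(2)[of "s + r * z"] by (simp add: power_mult_distrib)
qed

lemma cubic_growth_integrable:
  assumes "cubic_growth f"
  shows "integrable std_normal (\<lambda>z. f (s + r * z))"
proof -
  obtain K where K: "K \<ge> 0" "\<And>s. \<bar>f s\<bar> \<le> K * (1 + \<bar>s\<bar>) ^ 3"
    using assms by (auto simp: cubic_growth_def)
  note [measurable] = cubic_growth_measurable[OF assms]
  have "integrable std_normal (\<lambda>z. K * (1 + \<bar>s\<bar>) ^ 3 * (1 + \<bar>r\<bar> * \<bar>z\<bar>) ^ 3)"
    by (intro integrable_mult_right integrable_std_normal_cubic)
  then show ?thesis
    by (rule Bochner_Integration.integrable_bound)
       (use cubic_growth_shift_bound[OF K] in \<open>auto intro!: AE_I2 intro: order_trans[OF _ abs_ge_self]\<close>)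
qed

lemma cubic_growth_gauss_smooth:
  assumes "cubic_growth f"
  shows "cubic_growth (gauss_smooth r f)"
proof -
  obtain K where K: "K \<ge> 0" "\<And>s. \<bar>f s\<bar> \<le> K * (1 + \<bar>s\<bar>) ^ 3"
    using assms by (auto simp: cubic_growth_def)
  note [measurable] = cubic_growth_measurable[OF assms]
  let ?L = "\<integral>z. (1 + \<bar>r\<bar> * \<bar>z\<bar>) ^ 3 \<partial>std_normal"
  have "\<bar>gauss_smooth r f s\<bar> \<le> K * ?L * (1 + \<bar>s\<bar>) ^ 3" for s
  proof -
    have "\<bar>gauss_smooth r f s\<bar> \<le> (\<integral>z. \<bar>f (s + r * z)\<bar> \<partial>std_normal)"
      unfolding gauss_smooth_def by (rule integral_abs_bound)
    also have "\<dots> \<le> (\<integral>z. K * (1 + \<bar>s\<bar>) ^ 3 * (1 + \<bar>r\<bar> * \<bar>z\<bar>) ^ 3 \<partial>std_normal)"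
      by (intro integral_mono integrable_abs cubic_growth_integrable assms integrable_mult_right
          integrable_std_normal_cubic cubic_growth_shift_bound K)
    finally show ?thesis by (simp add: mult_ac)
  qed
  moreover have "K * ?L \<ge> 0"
    using K(1) by (intro mult_nonneg_nonneg integral_nonneg_AE) auto
  moreover have "gauss_smooth r f \<in> borel_measurable borel"
    unfolding gauss_smooth_def by measurable
  ultimately show ?thesis
    unfolding cubic_growth_def by blast
qed

text \<open>
  Averaging over shifts keeps the convexity for each \<open>s\<close>, and the symmetry of the normal law keeps
  the function even. This closure is what makes an induction on the number of summands possible.
\<close>
lemma spread_convex_gauss_smooth:
  assumes "spread_convex f" "cubic_growth f"
  shows "spread_convex (gauss_smooth r f)"
  unfolding spread_convex_def
proof (intro conjI allI)
  note [measurable] = cubic_growth_measurable[OF assms(2)]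
  note int = cubic_growth_integrable[OF assms(2)]
  have even: "f (- s) = f s" for s
    using assms(1) by (simp add: spread_convex_def)
  fix s
  have "gauss_smooth r f (- s) = (\<integral>z. f (- s + r * (- z)) \<partial>std_normal)"
    unfolding gauss_smooth_def by (rule integral_std_normal_reflect[symmetric]) simp
  also have "\<dots> = gauss_smooth r f s"
    unfolding gauss_smooth_def using even[of "s + r * z" for z] by (simp add: algebra_simps)
  finally show "gauss_smooth r f (- s) = gauss_smooth r f s" .
  show "convex_on {0..} (\<lambda>w. gauss_smooth r f (s + sqrt w) + gauss_smooth r f (s - sqrt w))"
  proof (rule convex_onI)
    fix \<theta> w w' :: real
    assume \<theta>: "0 < \<theta>" "\<theta> < 1" and w: "w \<in> {0..}" "w' \<in> {0..}"
    let ?h = "\<lambda>z v. f (s + r * z + sqrt v) + f (s + r * z - sqrt v)"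
    have h: "convex_on {0..} (?h z)" for z
      using assms(1) by (simp add: spread_convex_def)
    have int_h: "integrable std_normal (\<lambda>z. ?h z v)" for v
      using int[of "s + sqrt v" r] int[of "s - sqrt v" r] by (simp add: algebra_simps)
    have sum_h: "gauss_smooth r f (s + sqrt v) + gauss_smooth r f (s - sqrt v)
        = (\<integral>z. ?h z v \<partial>std_normal)" for v
      using int[of "s + sqrt v" r] int[of "s - sqrt v" r]
      by (simp add: gauss_smooth_def algebra_simps)
    have "(\<integral>z. ?h z ((1 - \<theta>) *\<^sub>R w + \<theta> *\<^sub>R w') \<partial>std_normal)
        \<le> (\<integral>z. (1 - \<theta>) * ?h z w + \<theta> * ?h z w' \<partial>std_normal)"
      by (intro integral_mono Bochner_Integration.integrable_add integrable_mult_right int_h convex_onD[OF h])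
         (use \<theta> w in auto)
    also have "\<dots> = (1 - \<theta>) * (\<integral>z. ?h z w \<partial>std_normal) + \<theta> * (\<integral>z. ?h z w' \<partial>std_normal)"
      by (subst Bochner_Integration.integral_add) (use int_h in auto)
    finally show "gauss_smooth r f (s + sqrt ((1 - \<theta>) *\<^sub>R w + \<theta> *\<^sub>R w'))
          + gauss_smooth r f (s - sqrt ((1 - \<theta>) *\<^sub>R w + \<theta> *\<^sub>R w'))
        \<le> (1 - \<theta>) * (gauss_smooth r f (s + sqrt w) + gauss_smooth r f (s - sqrt w))
          + \<theta> * (gauss_smooth r f (s + sqrt w') + gauss_smooth r f (s - sqrt w'))"
      by (simp only: sum_h)
  qed simp
qed

lemma integral_gauss_smooth:
  assumes "cubic_growth f" "r \<ge> 0" "q \<ge> 0"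
  shows "(\<integral>y. gauss_smooth q f (r * y) \<partial>std_normal) = (\<integral>z. f (sqrt (r\<^sup>2 + q\<^sup>2) * z) \<partial>std_normal)"
proof -
  interpret P: pair_prob_space std_normal std_normal ..
  note [measurable] = cubic_growth_measurable[OF assms(1)]
  let ?P = "std_normal \<Otimes>\<^sub>M std_normal" and ?r = "sqrt (r\<^sup>2 + q\<^sup>2)"
  have "integrable std_normal (\<lambda>z. f (?r * z))"
    using cubic_growth_integrable[OF assms(1), of 0 ?r] by simp
  then have "integrable (distr std_normal borel ((*) ?r)) f"
    by (subst integrable_distr_eq) auto
  then have "integrable ?P (\<lambda>x. f (case x of (y, z) \<Rightarrow> r * y + q * z))"
    unfolding std_normal_convolution[OF assms(2,3), symmetric]
    by (subst (asm) integrable_distr_eq) auto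
  then have "(\<integral>y. (\<integral>z. f (r * y + q * z) \<partial>std_normal) \<partial>std_normal)
      = (\<integral>x. f (case x of (y, z) \<Rightarrow> r * y + q * z) \<partial>?P)"
    using P.integral_fst[of "\<lambda>y z. f (r * y + q * z)"] by (simp add: case_prod_beta')
  also have "\<dots> = (\<integral>z. f z \<partial>distr ?P borel (\<lambda>(y, z). r * y + q * z))"
    by (rule integral_distr[symmetric]) auto
  also have "\<dots> = (\<integral>z. f (?r * z) \<partial>std_normal)"
    unfolding std_normal_convolution[OF assms(2,3)] by (rule integral_distr) auto
  finally show ?thesis
    by (simp add: gauss_smooth_def)
qed

text \<open>
  The squared norms of \<open>y + x\<close> and \<open>y - x\<close> are \<open>p + 2q\<close> and \<open>p - 2q\<close>, where \<open>p\<close> depends on the lengths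
  only and \<open>q\<close> is the inner product. Since \<open>f (sqrt w)\<close> is convex in \<open>w\<close>, the sum of the two values
  is largest for extreme \<open>q\<close>, that is, for parallel vectors.
\<close>
lemma spread_convex_norm:
  fixes x y :: "'a::real_inner"
  assumes "spread_convex f"
  shows "f (norm (y + x)) + f (norm (y - x)) \<le> f (norm y + norm x) + f (norm y - norm x)"
proof -
  define G where "G w = f (sqrt w)" for w
  have even: "f (- s) = f s" for s
    using assms by (simp add: spread_convex_def)
  have "convex_on {0..} (\<lambda>w. f (0 + sqrt w) + f (0 - sqrt w))"
    using assms unfolding spread_convex_def by blast
  then have "convex_on {0..} (\<lambda>w. 2 * G w)"
    by (simp add: G_def even)
  then have "convex_on {0..} (\<lambda>w. (1 / 2) * (2 * G w))"
    by (rule convex_on_cmul[rotated]) simp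
  then have G: "convex_on {0..} G" by simp
  define p m q where "p = (norm y)\<^sup>2 + (norm x)\<^sup>2" and "m = norm y * norm x" and "q = inner y x"
  have q: "\<bar>q\<bar> \<le> m"
    unfolding q_def m_def by (rule Cauchy_Schwarz_ineq2)
  have lhs: "f (norm (y + x)) = G (p + 2 * q)" "f (norm (y - x)) = G (p - 2 * q)"
    by (simp_all add: G_def p_def q_def norm_eq_sqrt_inner inner_diff inner_add inner_commute algebra_simps)
  have "f (norm y - norm x) = f \<bar>norm y - norm x\<bar>"
    using even[of "norm y - norm x"] by (cases "norm y \<ge> norm x") (auto simp: abs_if)
  also have "\<dots> = G (p - 2 * m)"
    by (simp add: G_def p_def m_def power2_diff mult.assoc flip: real_sqrt_abs)
  finally have rhs2: "f (norm y - norm x) = G (p - 2 * m)" .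
  have "f (norm y + norm x) = f \<bar>norm y + norm x\<bar>" by simp
  also have "\<dots> = G (p + 2 * m)"
    unfolding real_sqrt_abs[symmetric] by (simp add: G_def p_def m_def power2_sum algebra_simps)
  finally have rhs1: "f (norm y + norm x) = G (p + 2 * m)" .
  have pos: "p - 2 * m \<ge> 0" "p + 2 * m \<ge> 0"
    using sum_squares_bound[of "norm y" "norm x"] by (auto simp: p_def m_def)
  show ?thesis
  proof (cases "m = 0")
    case True
    then show ?thesis using q by (simp add: lhs rhs1 rhs2)
  next
    case False
    with q have m: "m > 0" by linarith
    define \<theta> where "\<theta> = (m + q) / (2 * m)"
    have \<theta>: "0 \<le> \<theta>" "\<theta> \<le> 1"
      using q m by (auto simp: \<theta>_def field_simps)
    have eq: "(1 - \<theta>) *\<^sub>R (p - 2 * m) + \<theta> *\<^sub>R (p + 2 * m) = p + 2 * q"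
      "(1 - \<theta>) *\<^sub>R (p + 2 * m) + \<theta> *\<^sub>R (p - 2 * m) = p - 2 * q"
      using m by (simp_all add: \<theta>_def field_simps)
    have "G (p + 2 * q) \<le> (1 - \<theta>) * G (p - 2 * m) + \<theta> * G (p + 2 * m)"
      "G (p - 2 * q) \<le> (1 - \<theta>) * G (p + 2 * m) + \<theta> * G (p - 2 * m)"
      using convex_onD[OF G \<theta>, of "p - 2 * m" "p + 2 * m"]
        convex_onD[OF G \<theta>, of "p + 2 * m" "p - 2 * m"] pos
      unfolding eq by auto
    then show ?thesis
      unfolding lhs rhs1 rhs2 left_diff_distrib by linarith
  qed
qed

lemma std_normal_AE_nonzero: "AE z in std_normal. z \<noteq> 0"
  unfolding std_normal_def
  by (subst AE_density) (use AE_lborel_singleton[of "0::real"] in auto)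

text \<open>
  A standard normal variable is a random sign times an independent factor with mean square 1. Given the
  factor, the mean over the sign is a convex function of its square, so Jensen's inequality applies.
\<close>
lemma spread_convex_le_gauss_smooth:
  assumes "spread_convex f" "cubic_growth f" "r \<ge> 0"
  shows "f (s + r) + f (s - r) \<le> 2 * gauss_smooth r f s"
proof (cases "r = 0")
  case True
  then show ?thesis by (simp add: gauss_smooth_def)
next
  case False
  then have r: "r > 0" using assms by simp
  note [measurable] = cubic_growth_measurable[OF assms(2)]
  note int = cubic_growth_integrable[OF assms(2)]
  let ?h = "\<lambda>w. f (s + sqrt w) + f (s - sqrt w)"
  have h_sq: "?h (r\<^sup>2 * z\<^sup>2) = f (s + r * z) + f (s + (- r) * z)" for z
    using r by (cases "z \<ge> 0") (auto simp: real_sqrt_mult)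
  have "?h (\<integral>z. r\<^sup>2 * z\<^sup>2 \<partial>std_normal) \<le> (\<integral>z. ?h (r\<^sup>2 * z\<^sup>2) \<partial>std_normal)"
  proof (rule std_normal.jensens_inequality[where I = "{0<..}"])
    show "integrable std_normal (\<lambda>z. r\<^sup>2 * z\<^sup>2)"
      using std_normal_second_moment by simp
    show "AE z in std_normal. r\<^sup>2 * z\<^sup>2 \<in> {0<..}"
      using std_normal_AE_nonzero by eventually_elim (use r in auto)
    show "integrable std_normal (\<lambda>z. ?h (r\<^sup>2 * z\<^sup>2))"
      unfolding h_sq by (intro Bochner_Integration.integrable_add int)
    have "convex_on {0..} ?h"
      using assms(1) by (simp add: spread_convex_def)
    then show "convex_on {0<..} ?h"
      by (rule convex_on_subset) auto
  qed auto
  also have "(\<integral>z. ?h (r\<^sup>2 * z\<^sup>2) \<partial>std_normal)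
      = (\<integral>z. f (s + r * z) \<partial>std_normal) + (\<integral>z. f (s + (- r) * z) \<partial>std_normal)"
    unfolding h_sq by (intro Bochner_Integration.integral_add int)
  also have "(\<integral>z. f (s + (- r) * z) \<partial>std_normal) = (\<integral>z. f (s + r * z) \<partial>std_normal)"
    using integral_std_normal_reflect[of "\<lambda>z. f (s + r * z)"] by simp
  finally show ?thesis
    using r by (simp add: std_normal_second_moment gauss_smooth_def)
qed

section \<open>Gaussian domination of signed sums\<close>

definition signed_sum :: "('i \<Rightarrow> 'a::real_vector) \<Rightarrow> 'i set \<Rightarrow> 'i set \<Rightarrow> 'a" where
  "signed_sum x I A = (\<Sum>i\<in>I. if i \<in> A then - x i else x i)"

lemma sum_Pow_insert:
  assumes "finite I" "k \<notin> I"
  shows "(\<Sum>A\<in>Pow (insert k I). g A) = (\<Sum>A\<in>Pow I. g A + (g (insert k A) :: real))"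
proof -
  have "(\<Sum>A\<in>Pow (insert k I). g A) = (\<Sum>A\<in>Pow I. g A) + (\<Sum>A\<in>insert k ` Pow I. g A)"
    unfolding Pow_insert by (rule sum.union_disjoint) (use assms in auto)
  also have "(\<Sum>A\<in>insert k ` Pow I. g A) = (\<Sum>A\<in>Pow I. g (insert k A))"
    by (rule sum.reindex[unfolded comp_def]) (use assms in \<open>auto simp: inj_on_def\<close>)
  finally show ?thesis
    by (simp add: sum.distrib)
qed

text \<open>
  One summand at a time: the sign of \<open>x k\<close> is replaced by a real normal factor acting along the length of
  the remaining sum, which turns \<open>f\<close> into \<open>gauss_smooth (norm (x k)) f\<close>. That function
  is again of the same kind, so the induction hypothesis, stated for all such functions, absorbs it, and the
  two Gaussian averages combine by the convolution identity.
\<close>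
theorem signed_sum_gauss_domination:
  fixes x :: "'i \<Rightarrow> 'a::real_inner"
  assumes "finite I" "spread_convex f" "cubic_growth f"
  shows "(\<Sum>A\<in>Pow I. f (norm (signed_sum x I A)))
       \<le> 2 ^ card I * (\<integral>z. f (sqrt (\<Sum>i\<in>I. (norm (x i))\<^sup>2) * z) \<partial>std_normal)"
  using assms
proof (induction I arbitrary: f rule: finite_induct)
  case empty
  then show ?case by (simp add: signed_sum_def)
next
  case (insert k I)
  let ?r = "norm (x k)" and ?a = "sqrt (\<Sum>i\<in>I. (norm (x i))\<^sup>2)"
  let ?F = "gauss_smooth ?r f"
  have a: "?a \<ge> 0" by (simp add: sum_nonneg)
  have plus: "signed_sum x (insert k I) A = signed_sum x I A + x k"
    and minus: "signed_sum x (insert k I) (insert k A) = signed_sum x I A - x k"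
    if "A \<in> Pow I" for A
  proof -
    have "k \<notin> A" using that insert.hyps by auto
    then show "signed_sum x (insert k I) A = signed_sum x I A + x k"
      using insert.hyps by (simp add: signed_sum_def)
    have "(\<Sum>i\<in>I. if i = k \<or> i \<in> A then - x i else x i) = (\<Sum>i\<in>I. if i \<in> A then - x i else x i)"
      using insert.hyps by (intro sum.cong) auto
    then show "signed_sum x (insert k I) (insert k A) = signed_sum x I A - x k"
      using insert.hyps by (simp add: signed_sum_def)
  qed
  have "(\<Sum>A\<in>Pow (insert k I). f (norm (signed_sum x (insert k I) A)))
      = (\<Sum>A\<in>Pow I. f (norm (signed_sum x I A + x k)) + f (norm (signed_sum x I A - x k)))"
    unfolding sum_Pow_insert[OF insert.hyps] by (intro sum.cong) (simp_all add: plus minus)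
  also have "\<dots> \<le> (\<Sum>A\<in>Pow I. 2 * ?F (norm (signed_sum x I A)))"
    by (intro sum_mono order_trans[OF spread_convex_norm spread_convex_le_gauss_smooth])
       (use insert.prems in auto)
  also have "\<dots> = 2 * (\<Sum>A\<in>Pow I. ?F (norm (signed_sum x I A)))"
    by (simp add: sum_distrib_left)
  also have "\<dots> \<le> 2 * (2 ^ card I * (\<integral>z. ?F (?a * z) \<partial>std_normal))"
    by (intro mult_left_mono insert.IH spread_convex_gauss_smooth cubic_growth_gauss_smooth insert.prems) auto
  also have "(\<integral>z. ?F (?a * z) \<partial>std_normal) = (\<integral>z. f (sqrt (?a\<^sup>2 + ?r\<^sup>2) * z) \<partial>std_normal)"
    by (rule integral_gauss_smooth) (use insert.prems a in auto)
  also have "?a\<^sup>2 + ?r\<^sup>2 = (\<Sum>i\<in>insert k I. (norm (x i))\<^sup>2)"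
    using insert.hyps by (simp add: sum_nonneg)
  finally show ?case
    using insert.hyps by simp
qed

section \<open>Even functions with convex second derivative\<close>

text \<open>
  Nothing is asked of the derivative at the endpoint, where the functions \<open>f (s + sqrt w)\<close>
  have a singular chain rule.
\<close>
lemma convex_on_halfline_of_deriv_mono:
  fixes h h' :: "real \<Rightarrow> real"
  assumes cont: "continuous_on {0..} h"
    and deriv: "\<And>w. w > 0 \<Longrightarrow> DERIV h w :> h' w"
    and mono: "\<And>v w. 0 < v \<Longrightarrow> v \<le> w \<Longrightarrow> h' v \<le> h' w"
  shows "convex_on {0..} h"
proof (rule convex_on_linorderI)
  fix \<theta> x y :: real
  assume \<theta>: "0 < \<theta>" "\<theta> < 1" and xy: "x \<in> {0..}" "y \<in> {0..}" "x < y"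
  define z where "z = (1 - \<theta>) * x + \<theta> * y"
  have zx: "z - x = \<theta> * (y - x)" and yz: "y - z = (1 - \<theta>) * (y - x)"
    by (simp_all add: z_def algebra_simps)
  have "z - x > 0" "y - z > 0"
    unfolding zx yz using \<theta> xy by auto
  then have z: "x < z" "z < y" by auto
  have slope: "\<exists>c. a < c \<and> c < b \<and> h b - h a = (b - a) * h' c" if ab: "0 \<le> a" "a < b" for a b
  proof -
    have "continuous_on {a..b} h"
      by (rule continuous_on_subset[OF cont]) (use ab in auto)
    moreover have "h differentiable (at w)" if "a < w" "w < b" for w
      using deriv[of w] \<open>0 \<le> a\<close> that real_differentiable_def by force
    ultimately obtain l c where c: "a < c" "c < b" "DERIV h c :> l" "h b - h a = (b - a) * l"
      using MVT[OF ab(2)] by blast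
    moreover have "l = h' c"
      using DERIV_unique[OF c(3) deriv[of c]] c(1) ab by simp
    ultimately show ?thesis by blast
  qed
  obtain c where c: "x < c" "c < z" "h z - h x = (z - x) * h' c"
    using slope[of x z] xy z by auto
  obtain d where d: "z < d" "d < y" "h y - h z = (y - z) * h' d"
    using slope[of z y] xy z by auto
  have "h' c \<le> h' d"
    using c d xy by (intro mono) auto
  then have "(1 - \<theta>) * (\<theta> * (y - x)) * h' c \<le> (1 - \<theta>) * (\<theta> * (y - x)) * h' d"
    using \<theta> xy by (intro mult_left_mono) auto
  then have "(1 - \<theta>) * (h z - h x) \<le> \<theta> * (h y - h z)"
    unfolding c(3) d(3) zx yz by (simp add: mult_ac)
  then show "h ((1 - \<theta>) *\<^sub>R x + \<theta> *\<^sub>R y) \<le> (1 - \<theta>) * h x + \<theta> * h y"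
    by (simp add: z_def algebra_simps)
qed simp

text \<open>
  With \<open>k v = f' (s + v) - f' (s - v)\<close>, the derivative in \<open>w = v\<^sup>2\<close> is \<open>k v / (2 * v)\<close>. The derivative
  of \<open>k\<close> is the even convex function \<open>f'' (s + v) + f'' (s - v)\<close> of \<open>v\<close>, hence increasing for \<open>v \<ge> 0\<close>; so
  \<open>k\<close> is convex there with \<open>k 0 = 0\<close>, and its slopes \<open>k v / v\<close> from the origin increase.
\<close>
lemma spread_convex_of_convex_second_deriv:
  fixes f f' f'' :: "real \<Rightarrow> real"
  assumes even: "\<And>s. f (- s) = f s"
    and f': "\<And>s. DERIV f s :> f' s"
    and f'': "\<And>s. DERIV f' s :> f'' s"
    and convex: "convex_on UNIV f''"
  shows "spread_convex f"
  unfolding spread_convex_def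
proof (intro conjI allI even)
  fix s
  define k where "k v = f' (s + v) - f' (s - v)" for v
  define k' where "k' v = f'' (s + v) + f'' (s - v)" for v
  have deriv_k: "DERIV k v :> k' v" for v
    unfolding k_def k'_def by (auto intro!: derivative_eq_intros DERIV_chain2[OF f''])
  have mono_k': "k' v \<le> k' w" if "0 \<le> v" "v \<le> w" for v w
  proof (cases "w = 0")
    case True
    with that show ?thesis by simp
  next
    case False
    with that have w: "w > 0" by simp
    define \<theta> where "\<theta> = (w + v) / (2 * w)"
    have \<theta>: "0 \<le> \<theta>" "\<theta> \<le> 1" using that w by (auto simp: \<theta>_def field_simps)
    have eq: "(1 - \<theta>) *\<^sub>R (s - w) + \<theta> *\<^sub>R (s + w) = s + v"
      "(1 - \<theta>) *\<^sub>R (s + w) + \<theta> *\<^sub>R (s - w) = s - v"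
      using w by (simp_all add: \<theta>_def field_simps)
    show ?thesis
      using convex_onD[OF convex \<theta>, of "s - w" "s + w"] convex_onD[OF convex \<theta>, of "s + w" "s - w"]
      unfolding eq k'_def by (simp add: algebra_simps)
  qed
  have slope_mono: "k v / v \<le> k w / w" if vw: "0 < v" "v \<le> w" for v w
  proof (cases "v = w")
    case False
    then have vw': "v < w" using vw by simp
    obtain c where c: "0 < c" "c < v" "k v - k 0 = (v - 0) * k' c"
      using MVT2[OF vw(1), of k k'] deriv_k by auto
    obtain d where d: "v < d" "d < w" "k w - k v = (w - v) * k' d"
      using MVT2[OF vw', of k k'] deriv_k by auto
    have k0: "k 0 = 0" by (simp add: k_def)
    have "(w - v) * k' c \<le> (w - v) * k' d"
      using c d vw by (intro mult_left_mono mono_k') auto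
    then have "(w - v) * k' c \<le> k w - v * k' c"
      using c(3) d(3) k0 by simp
    then have "w * k' c \<le> k w" by (simp add: algebra_simps)
    then show ?thesis
      using c(3) k0 vw vw' by (simp add: field_simps)
  qed simp
  show "convex_on {0..} (\<lambda>w. f (s + sqrt w) + f (s - sqrt w))"
  proof (rule convex_on_halfline_of_deriv_mono[where h' = "\<lambda>w. (k (sqrt w) / sqrt w) / 2"])
    have "continuous_on UNIV f"
      using f' by (auto intro!: continuous_at_imp_continuous_on DERIV_isCont)
    then have comp: "continuous_on {0..} (\<lambda>w. f (g w))" if "continuous_on {0..} g" for g :: "real \<Rightarrow> real"
      by (rule continuous_on_compose2) (use that in auto)
    then show "continuous_on {0..} (\<lambda>w. f (s + sqrt w) + f (s - sqrt w))"
      by (intro continuous_on_add comp) (auto intro!: continuous_intros)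
    show "DERIV (\<lambda>w. f (s + sqrt w) + f (s - sqrt w)) w :> (k (sqrt w) / sqrt w) / 2" if "w > 0" for w
    proof -
      have "DERIV (\<lambda>w. s + sqrt w) w :> inverse (sqrt w) / 2"
        "DERIV (\<lambda>w. s - sqrt w) w :> - (inverse (sqrt w) / 2)"
        using that by (auto intro!: derivative_eq_intros)
      note deriv = DERIV_add[OF DERIV_chain2[OF f' this(1)] DERIV_chain2[OF f' this(2)]]
      have "f' (s + sqrt w) * (inverse (sqrt w) / 2) + f' (s - sqrt w) * - (inverse (sqrt w) / 2)
          = (k (sqrt w) / sqrt w) / 2"
        using that unfolding k_def by (simp add: field_simps)
      with deriv show ?thesis by metis
    qed
    show "(k (sqrt v) / sqrt v) / 2 \<le> (k (sqrt w) / sqrt w) / 2" if "0 < v" "v \<le> w" for v w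
      using slope_mono[of "sqrt v" "sqrt w"] that by (simp add: divide_right_mono)
  qed
qed

text \<open>
  For \<open>t \<ge> 0\<close> this is the cube of the positive part of \<open>\<bar>s\<bar> - t\<close>. The two-term form avoids the
  absolute value and is twice differentiable term by term for every \<open>t\<close>.
\<close>
definition cubic_excess :: "real \<Rightarrow> real \<Rightarrow> real" where
  "cubic_excess t s = (max 0 (s - t)) ^ 3 + (max 0 (- s - t)) ^ 3"

lemma DERIV_max_zero_power:
  fixes x :: real
  shows "DERIV (\<lambda>x. (max 0 x) ^ Suc (Suc n)) x :> real (Suc (Suc n)) * (max 0 x) ^ Suc n"
proof (cases "x = 0")
  case True
  have "((\<lambda>h::real. (max 0 h) ^ Suc n) \<longlongrightarrow> (max 0 0) ^ Suc n) (at 0)"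
    by (intro tendsto_intros)
  then have "((\<lambda>h::real. (max 0 h) ^ Suc n) \<longlongrightarrow> 0) (at 0)" by simp
  moreover have "\<forall>\<^sub>F h::real in at 0. (max 0 h) ^ Suc n = (max 0 h) ^ Suc (Suc n) / h"
    by (auto simp: eventually_at_filter max_def)
  ultimately have "((\<lambda>h::real. (max 0 h) ^ Suc (Suc n) / h) \<longlongrightarrow> 0) (at 0)"
    by (rule Lim_transform_eventually)
  then show ?thesis
    using True by (simp add: DERIV_def)
next
  case False
  then consider "x > 0" | "x < 0" by linarith
  then show ?thesis
  proof cases
    case 1
    have "DERIV (\<lambda>x. x ^ Suc (Suc n)) x :> real (Suc (Suc n)) * (max 0 x) ^ Suc n"
      using 1 DERIV_pow[of "Suc (Suc n)" x] by simp
    then show ?thesis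
      by (rule has_field_derivative_transform_within_open[of _ _ _ "{0<..}"]) (use 1 in auto)
  next
    case 2
    have "DERIV (\<lambda>x. 0) x :> real (Suc (Suc n)) * (max 0 x) ^ Suc n"
      using 2 by auto
    then show ?thesis
      by (rule has_field_derivative_transform_within_open[of _ _ _ "{..<0}"]) (use 2 in auto)
  qed
qed

lemma spread_convex_cubic_excess: "spread_convex (cubic_excess t)"
proof (rule spread_convex_of_convex_second_deriv)
  have cube: "DERIV (\<lambda>x::real. (max 0 x) ^ 3) x :> 3 * (max 0 x)\<^sup>2" for x
    using DERIV_max_zero_power[of 1 x] by (simp add: eval_nat_numeral)
  have square: "DERIV (\<lambda>x::real. (max 0 x)\<^sup>2) x :> 2 * max 0 x" for x
    using DERIV_max_zero_power[of 0 x] by (simp add: eval_nat_numeral)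
  show "cubic_excess t (- s) = cubic_excess t s" for s
    by (simp add: cubic_excess_def)
  have affine: "DERIV (\<lambda>s. c * s - t) s :> c" for c s
    by (auto intro!: derivative_eq_intros)
  have cube_affine: "DERIV (\<lambda>s. (max 0 (c * s - t)) ^ 3) s :> 3 * (max 0 (c * s - t))\<^sup>2 * c" for c s
    by (rule DERIV_chain2[OF cube affine])
  have square_affine: "DERIV (\<lambda>s. (max 0 (c * s - t))\<^sup>2) s :> 2 * max 0 (c * s - t) * c" for c s
    by (rule DERIV_chain2[OF square affine])
  show "DERIV (cubic_excess t) s :> 3 * (max 0 (s - t))\<^sup>2 - 3 * (max 0 (- s - t))\<^sup>2" for s
    using DERIV_add[OF cube_affine[of 1 s] cube_affine[of "-1" s]] by (simp add: cubic_excess_def[abs_def])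
  show "DERIV (\<lambda>s. 3 * (max 0 (s - t))\<^sup>2 - 3 * (max 0 (- s - t))\<^sup>2) s
      :> 6 * (max 0 (s - t) + max 0 (- s - t))" for s
    using DERIV_diff[OF DERIV_cmult[OF square_affine[of 1 s], of 3] DERIV_cmult[OF square_affine[of "-1" s], of 3]]
    by (simp add: algebra_simps)
  have "convex_on UNIV (\<lambda>s. max 0 (c * s - t))" for c
  proof (rule convex_onI)
    fix \<theta> x y :: real assume "0 < \<theta>" "\<theta> < 1"
    then have "(1 - \<theta>) * (c * x - t) \<le> (1 - \<theta>) * max 0 (c * x - t)"
      "\<theta> * (c * y - t) \<le> \<theta> * max 0 (c * y - t)"
      "0 \<le> (1 - \<theta>) * max 0 (c * x - t)" "0 \<le> \<theta> * max 0 (c * y - t)"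
      by (auto intro!: mult_left_mono)
    then show "max 0 (c * ((1 - \<theta>) *\<^sub>R x + \<theta> *\<^sub>R y) - t)
        \<le> (1 - \<theta>) * max 0 (c * x - t) + \<theta> * max 0 (c * y - t)"
      by (intro max.boundedI) (auto simp: algebra_simps)
  qed simp
  from this[of 1] this[of "-1"]
  show "convex_on UNIV (\<lambda>s. 6 * (max 0 (s - t) + max 0 (- s - t)))"
    by (intro convex_on_cmul convex_on_add) auto
qed

lemma cubic_growth_cubic_excess:
  assumes "t \<ge> 0"
  shows "cubic_growth (cubic_excess t)"
  unfolding cubic_growth_def
proof (intro conjI exI[of _ 2] allI)
  show "cubic_excess t \<in> borel_measurable borel"
    unfolding cubic_excess_def by measurable
  fix s
  have "(max 0 (s - t)) ^ 3 \<le> (1 + \<bar>s\<bar>) ^ 3" "(max 0 (- s - t)) ^ 3 \<le> (1 + \<bar>s\<bar>) ^ 3"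
    using assms by (auto intro!: power_mono)
  moreover have "0 \<le> (max 0 (s - t)) ^ 3" "0 \<le> (max 0 (- s - t)) ^ 3"
    by simp_all
  ultimately show "\<bar>cubic_excess t s\<bar> \<le> 2 * (1 + \<bar>s\<bar>) ^ 3"
    unfolding cubic_excess_def by linarith
qed simp

lemma spread_convex_square: "spread_convex (\<lambda>s. s\<^sup>2)"
proof (rule spread_convex_of_convex_second_deriv)
  show "DERIV (\<lambda>s::real. s\<^sup>2) s :> 2 * s" "DERIV (\<lambda>s::real. 2 * s) s :> 2" for s
    by (auto intro!: derivative_eq_intros)
qed (auto simp: convex_on_const)

lemma cubic_growth_square: "cubic_growth (\<lambda>s. s\<^sup>2)"
  unfolding cubic_growth_def
proof (intro conjI exI[of _ 1] allI)
  fix s :: real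
  have "\<bar>s\<bar>\<^sup>2 \<le> (1 + \<bar>s\<bar>)\<^sup>2" by (intro power_mono) auto
  also have "\<dots> \<le> (1 + \<bar>s\<bar>) ^ 3" by (intro power_increasing) auto
  finally show "\<bar>s\<^sup>2\<bar> \<le> 1 * (1 + \<bar>s\<bar>) ^ 3" by simp
qed auto

section \<open>Tails of the standard normal law\<close>

definition std_normal_tail :: "real \<Rightarrow> real" where
  "std_normal_tail v = measure std_normal {v..}"

lemma has_bochner_integral_le:
  fixes f g :: "'a \<Rightarrow> real"
  assumes "has_bochner_integral M f a" "has_bochner_integral M g b" "\<And>x. f x \<le> g x"
  shows "a \<le> b"
  using integral_mono[of M f g] assms by (auto simp: has_bochner_integral_iff)

lemma has_bochner_integral_FTC_atLeast:
  fixes f F :: "real \<Rightarrow> real"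
  assumes "f \<in> borel_measurable borel"
    and "\<And>x. a \<le> x \<Longrightarrow> DERIV F x :> f x"
    and "\<And>x. a \<le> x \<Longrightarrow> 0 \<le> f x"
    and "(F \<longlongrightarrow> L) at_top"
  shows "has_bochner_integral lborel (\<lambda>x. f x * indicator {a..} x) (L - F a)"
proof (rule has_bochner_integral_nn_integral)
  have "F a \<le> F x" if "a \<le> x" for x
    using that assms(2,3) by (intro DERIV_nonneg_imp_nondecreasing[of a x F]) (auto intro: order_trans)
  then have "eventually (\<lambda>x. F a \<le> F x) at_top"
    by (rule eventually_mono[OF eventually_ge_at_top])
  then have "F a \<le> L"
    by (intro tendsto_lowerbound[OF assms(4)]) auto
  then show "0 \<le> L - F a" by simp
  have "(\<integral>\<^sup>+x. ennreal (f x * indicator {a..} x) \<partial>lborel) = (\<integral>\<^sup>+x. ennreal (f x) * indicator {a..} x \<partial>lborel)"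
    by (intro nn_integral_cong) (auto split: split_indicator)
  also have "\<dots> = ennreal (L - F a)"
    by (rule nn_integral_FTC_atLeast[OF assms]) auto
  finally show "(\<integral>\<^sup>+x. ennreal (f x * indicator {a..} x) \<partial>lborel) = ennreal (L - F a)" .
qed (use assms in \<open>auto split: split_indicator\<close>)

lemma has_bochner_integral_std_normal_tail:
  "has_bochner_integral lborel (\<lambda>z. std_normal_density z * indicator {v..} z) (std_normal_tail v)"
proof (rule has_bochner_integral_nn_integral)
  have "(\<integral>\<^sup>+z. ennreal (std_normal_density z * indicator {v..} z) \<partial>lborel)
      = (\<integral>\<^sup>+z. ennreal (std_normal_density z) * indicator {v..} z \<partial>lborel)"
    by (intro nn_integral_cong) (auto split: split_indicator)
  also have "\<dots> = emeasure std_normal {v..}"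
    unfolding std_normal_def by (rule emeasure_density[symmetric]) auto
  finally show "(\<integral>\<^sup>+z. ennreal (std_normal_density z * indicator {v..} z) \<partial>lborel) = ennreal (std_normal_tail v)"
    by (simp add: std_normal_tail_def std_normal.emeasure_eq_measure)
qed (auto simp: std_normal_tail_def)

lemma measure_std_normal_singleton [simp]: "measure std_normal {v} = 0"
proof -
  have "emeasure std_normal {v} = (\<integral>\<^sup>+z. ennreal (std_normal_density z) * indicator {v} z \<partial>lborel)"
    unfolding std_normal_def by (rule emeasure_density) auto
  also have "\<dots> = 0"
  proof (subst nn_integral_0_iff_AE)
    show "AE z in lborel. ennreal (std_normal_density z) * indicator {v} z = 0"
      using AE_lborel_singleton[of v] by eventually_elim auto
  qed simp_all
  finally show ?thesis by (simp add: measure_def)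
qed

lemma measure_std_normal_two_sided:
  assumes "v \<ge> 0"
  shows "measure std_normal {z. v < \<bar>z\<bar>} = 2 * std_normal_tail v"
proof -
  have "measure std_normal {v..} = measure std_normal ({v} \<union> {v<..})"
    by (intro arg_cong[where f = "measure std_normal"]) auto
  also have "\<dots> = measure std_normal {v<..}"
    by (subst std_normal.finite_measure_Union) auto
  finally have right: "measure std_normal {v<..} = std_normal_tail v"
    by (simp add: std_normal_tail_def)
  have "measure std_normal {..<- v} = measure (distr std_normal borel uminus) {..<- v}"
    by (simp add: std_normal_uminus)
  also have "\<dots> = measure std_normal {v<..}"
    by (subst measure_distr) (auto intro!: arg_cong[where f = "measure std_normal"])
  finally have left: "measure std_normal {..<- v} = std_normal_tail v"
    by (simp add: right)
  have "{z. v < \<bar>z\<bar>} = {v<..} \<union> {..<- v}"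
    using assms by auto
  then show ?thesis
    using assms by (simp add: std_normal.finite_measure_Union left right disjoint_iff)
qed

lemma std_normal_tail_antimono: "v \<le> w \<Longrightarrow> std_normal_tail w \<le> std_normal_tail v"
  unfolding std_normal_tail_def by (intro std_normal.finite_measure_mono) auto

lemma DERIV_std_normal_density:
  "DERIV std_normal_density z :> - z * std_normal_density z"
proof -
  have "DERIV (\<lambda>z::real. exp (- z\<^sup>2 / 2)) z :> - z * exp (- z\<^sup>2 / 2)"
    by (auto intro!: derivative_eq_intros)
  from DERIV_cmult[OF this, of "1 / sqrt (2 * pi)"] show ?thesis
    unfolding std_normal_density_def[abs_def] by (simp add: mult_ac)
qed

lemma std_normal_density_pos: "std_normal_density z > 0"
  by (rule normal_density_pos) simp

text \<open>
  For \<open>v > 0\<close>, on \<open>{v..}\<close> the density \<open>\<phi> z\<close> is at most \<open>(z / v) * \<phi> z\<close>, which is the derivative of \<open>- \<phi> z / v\<close>.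
\<close>
lemma Mills_upper_bound: "v * std_normal_tail v \<le> std_normal_density v"
proof (cases "v > 0")
  case True
  have "((\<lambda>z. - std_normal_density z) \<longlongrightarrow> 0) at_top"
    unfolding std_normal_density_def by real_asymp
  then have *: "has_bochner_integral lborel (\<lambda>z. (z * std_normal_density z) * indicator {v..} z) (0 - (- std_normal_density v))"
    by (intro has_bochner_integral_FTC_atLeast)
       (use True DERIV_std_normal_density in \<open>auto intro!: derivative_eq_intros\<close>)
  have "has_bochner_integral lborel (\<lambda>z. v * (std_normal_density z * indicator {v..} z)) (v * std_normal_tail v)"
    by (intro has_bochner_integral_mult_right has_bochner_integral_std_normal_tail)
  then show ?thesis
    by (rule has_bochner_integral_le[OF _ *[simplified]]) (auto split: split_indicator intro: mult_right_mono)
next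
  case False
  then have "v * std_normal_tail v \<le> 0"
    by (simp add: std_normal_tail_def mult_le_0_iff)
  then show ?thesis
    using std_normal_density_pos[of v] by linarith
qed

text \<open>
  The derivative of \<open>- z / (1 + z\<^sup>2) * \<phi> z\<close> is \<open>(1 - 2 / (1 + z\<^sup>2)\<^sup>2) * \<phi> z\<close>, which is at most
  \<open>\<phi> z\<close>. The restriction \<open>v \<ge> 1\<close> makes this derivative nonnegative, so that it can be integrated up to
  infinity without checking integrability.
\<close>
lemma Mills_lower_bound:
  assumes "v \<ge> 1"
  shows "v / (1 + v\<^sup>2) * std_normal_density v \<le> std_normal_tail v"
proof -
  let ?g = "\<lambda>z::real. 1 - 2 / (1 + z\<^sup>2)\<^sup>2" and ?F = "\<lambda>z::real. - (z / (1 + z\<^sup>2) * std_normal_density z)"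
  have pos: "1 + z\<^sup>2 > 0" for z :: real
    by (simp add: add_pos_nonneg)
  have deriv: "DERIV ?F z :> ?g z * std_normal_density z" for z
  proof -
    have q: "DERIV (\<lambda>z. z / (1 + z\<^sup>2)) z :> (1 - z\<^sup>2) / (1 + z\<^sup>2)\<^sup>2"
      using pos[of z] by (auto intro!: derivative_eq_intros simp: power2_eq_square field_simps)
    have "- ((1 - z\<^sup>2) / (1 + z\<^sup>2)\<^sup>2 - z\<^sup>2 / (1 + z\<^sup>2)) = ?g z"
    proof -
      define d where "d = 1 + z\<^sup>2"
      have "z\<^sup>2 = d - 1" "d > 0" using pos[of z] by (simp_all add: d_def)
      then show ?thesis
        by (simp only:) (simp add: field_simps power2_eq_square)
    qed
    moreover have "- ((1 - z\<^sup>2) / (1 + z\<^sup>2)\<^sup>2 * std_normal_density z + - z * std_normal_density z * (z / (1 + z\<^sup>2)))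
        = - ((1 - z\<^sup>2) / (1 + z\<^sup>2)\<^sup>2 - z\<^sup>2 / (1 + z\<^sup>2)) * std_normal_density z"
      by (simp add: power2_eq_square algebra_simps)
    ultimately show ?thesis
      using DERIV_minus[OF DERIV_mult[OF q DERIV_std_normal_density]] by simp
  qed
  have g: "0 \<le> ?g z" "?g z \<le> 1" if "v \<le> z" for z
  proof -
    have "1 \<le> z\<^sup>2" using that assms by (simp add: one_le_power)
    then have "2\<^sup>2 \<le> (1 + z\<^sup>2)\<^sup>2" by (intro power_mono) auto
    then show "0 \<le> ?g z" using pos[of z] by (simp add: field_simps)
  qed simp
  have "(?F \<longlongrightarrow> 0) at_top"
    unfolding std_normal_density_def by real_asymp
  then have "has_bochner_integral lborel (\<lambda>z. (?g z * std_normal_density z) * indicator {v..} z) (0 - ?F v)"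
    by (intro has_bochner_integral_FTC_atLeast deriv) (use g in auto)
  then have "0 - ?F v \<le> std_normal_tail v"
    by (rule has_bochner_integral_le[OF _ has_bochner_integral_std_normal_tail])
       (use g in \<open>auto split: split_indicator intro!: mult_left_le_one_le\<close>)
  then show ?thesis by simp
qed

lemma std_normal_tail_pos: "std_normal_tail v > 0"
proof -
  let ?w = "max 1 v"
  have "0 < ?w / (1 + ?w\<^sup>2) * std_normal_density ?w"
    by (intro mult_pos_pos divide_pos_pos std_normal_density_pos) (auto simp: add_pos_nonneg)
  also have "\<dots> \<le> std_normal_tail ?w" by (rule Mills_lower_bound) simp
  also have "\<dots> \<le> std_normal_tail v" by (rule std_normal_tail_antimono) simp
  finally show ?thesis .
qed

lemma has_bochner_integral_cubic_exp:
  assumes "c > (0::real)"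
  shows "has_bochner_integral lborel (\<lambda>z. ((z - t) ^ 3 * exp (- c * (z - t))) * indicator {t..} z) (6 / c ^ 4)"
proof -
  let ?p = "\<lambda>z. (z - t) ^ 3 / c + 3 * (z - t)\<^sup>2 / c\<^sup>2 + 6 * (z - t) / c ^ 3 + 6 / c ^ 4"
  let ?F = "\<lambda>z. - (exp (- c * (z - t)) * ?p z)"
  have "DERIV ?F z :> (z - t) ^ 3 * exp (- c * (z - t))" for z
  proof -
    let ?p' = "3 * (z - t)\<^sup>2 / c + 6 * (z - t) / c\<^sup>2 + 6 / c ^ 3"
    have E: "DERIV (\<lambda>z. exp (- c * (z - t))) z :> - c * exp (- c * (z - t))"
      by (auto intro!: derivative_eq_intros)
    have P: "DERIV ?p z :> ?p'"
    proof -
      have "DERIV (\<lambda>z. (z - t) ^ 3) z :> 3 * (z - t)\<^sup>2" "DERIV (\<lambda>z. 3 * (z - t)\<^sup>2) z :> 6 * (z - t)"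
        "DERIV (\<lambda>z. 6 * (z - t)) z :> 6"
        by (auto intro!: derivative_eq_intros)
      from DERIV_add[OF DERIV_add[OF DERIV_add[OF DERIV_cdivide[OF this(1), of c]
          DERIV_cdivide[OF this(2), of "c\<^sup>2"]] DERIV_cdivide[OF this(3), of "c ^ 3"]] DERIV_const[of "6 / c ^ 4"]]
      show ?thesis by simp
    qed
    have "c * ?p z - ?p' = (z - t) ^ 3"
      using assms by (simp add: distrib_left power_eq_if)
    moreover have "- (- c * exp (- c * (z - t)) * ?p z + ?p' * exp (- c * (z - t)))
        = (c * ?p z - ?p') * exp (- c * (z - t))"
      by (simp only: left_diff_distrib) (simp add: mult_ac)
    ultimately show ?thesis
      using DERIV_minus[OF DERIV_mult[OF E P]] by simp
  qed
  moreover have "(?F \<longlongrightarrow> 0) at_top"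
    using assms by real_asymp
  ultimately have "has_bochner_integral lborel (\<lambda>z. ((z - t) ^ 3 * exp (- c * (z - t))) * indicator {t..} z) (0 - ?F t)"
    by (intro has_bochner_integral_FTC_atLeast) auto
  then show ?thesis by simp
qed

lemma has_bochner_integral_exp_tail:
  assumes "c > (0::real)"
  shows "has_bochner_integral lborel (\<lambda>z. exp (- c * (z - v)) * indicator {v..} z) (1 / c)"
proof -
  let ?F = "\<lambda>z. - (exp (- c * (z - v)) / c)"
  have "DERIV ?F z :> exp (- c * (z - v))" for z
    using assms by (auto intro!: derivative_eq_intros)
  moreover have "(?F \<longlongrightarrow> 0) at_top"
    using assms by real_asymp
  ultimately have "has_bochner_integral lborel (\<lambda>z. exp (- c * (z - v)) * indicator {v..} z) (0 - ?F v)"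
    by (intro has_bochner_integral_FTC_atLeast) auto
  then show ?thesis by simp
qed

section \<open>Truncated cubic moments against the tail\<close>

text \<open>
  The exponential through \<open>(v, \<phi> v)\<close> with rate \<open>c\<close> meets the density only at \<open>v\<close> and at
  \<open>2 * c - v\<close>, because the logarithm of the ratio is a quadratic polynomial.
\<close>
lemma density_compare_exp_tangent:
  shows "std_normal_density z \<le> std_normal_density v * exp (- c * (z - v)) \<longleftrightarrow> 0 \<le> (z - v) * (z - (2 * c - v))"
    and "std_normal_density v * exp (- c * (z - v)) \<le> std_normal_density z \<longleftrightarrow> (z - v) * (z - (2 * c - v)) \<le> 0"
proof -
  have K: "1 / sqrt (2 * pi) > 0" by simp
  have "- z\<^sup>2 / 2 \<le> - v\<^sup>2 / 2 + - c * (z - v) \<longleftrightarrow> 0 \<le> (z - v) * (z - (2 * c - v))"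
    "- v\<^sup>2 / 2 + - c * (z - v) \<le> - z\<^sup>2 / 2 \<longleftrightarrow> (z - v) * (z - (2 * c - v)) \<le> 0"
    by (simp_all add: power2_eq_square field_simps)
  then show "std_normal_density z \<le> std_normal_density v * exp (- c * (z - v)) \<longleftrightarrow> 0 \<le> (z - v) * (z - (2 * c - v))"
    "std_normal_density v * exp (- c * (z - v)) \<le> std_normal_density z \<longleftrightarrow> (z - v) * (z - (2 * c - v)) \<le> 0"
    unfolding std_normal_density_def mult.assoc exp_add[symmetric] mult_le_cancel_left_pos[OF K] exp_le_cancel_iff by this+
qed

text \<open>
  Replace the normal law by the exponential density \<open>g z = \<phi> v * exp (- c * (z - v))\<close>, where the
  hazard rate \<open>c\<close> is chosen so that \<open>g\<close> and \<open>\<phi>\<close> give the same mass to \<open>{v..}\<close>. Below \<open>v\<close> the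
  density \<open>\<phi>\<close> is smaller than \<open>g\<close>. Above \<open>v\<close> it is larger than \<open>g\<close> up to the second crossing point
  \<open>w = 2 * c - v\<close> and smaller afterwards, so, the masses being equal, \<open>g\<close> is the more spread out one and gives
  an increasing function the larger integral. With \<open>t = v - 3 / c\<close>, the third moment over \<open>{t..}\<close>
  of \<open>g\<close> about \<open>t\<close> is exactly the right-hand side.
\<close>
lemma truncated_cubic_moment_bound:
  fixes v :: real
  defines "c \<equiv> std_normal_density v / std_normal_tail v"
  defines "t \<equiv> v - 3 / c"
  shows "(\<integral>z. (max 0 (z - t)) ^ 3 \<partial>std_normal) \<le> 2 * exp 3 / 9 * (v - t) ^ 3 * std_normal_tail v"
proof -
  let ?\<phi> = std_normal_density and ?T = "std_normal_tail v"
  have T: "?T > 0" by (rule std_normal_tail_pos)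
  have c: "c > 0" unfolding c_def using T std_normal_density_pos by simp
  have cT: "?\<phi> v = c * ?T" using T by (simp add: c_def)
  have t: "t < v" using c by (simp add: t_def)
  have "v * ?T \<le> c * ?T" using Mills_upper_bound[of v] cT by simp
  then have vc: "v \<le> c" using T by simp
  define w where "w = 2 * c - v"
  have w: "v \<le> w" using vc by (simp add: w_def)
  let ?h = "\<lambda>z. (max 0 (z - t)) ^ 3"
  let ?I = "\<lambda>z. ((z - t) ^ 3 * exp (- c * (z - t))) * indicator {t..} z"
  let ?J = "\<lambda>z. ?\<phi> z * indicator {v..} z - ?\<phi> v * (exp (- c * (z - v)) * indicator {v..} z)"
  have "c * (v - t) = 3" using c by (simp add: t_def)
  then have shift: "exp (- c * (z - v)) = exp 3 * exp (- c * (z - t))" for z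
    by (simp add: exp_add[symmetric] algebra_simps)
  have h_mono: "?h x \<le> ?h y" if "x \<le> y" for x y
    using that by (intro power_mono) auto
  \<comment> \<open>Between \<open>t\<close> and \<open>v\<close> this is \<open>\<phi> z \<le> g z\<close>, and beyond \<open>v\<close> it is
    \<open>(\<phi> z - g z) * (h z - h w) \<le> 0\<close>. The last term integrates to zero by the choice of \<open>c\<close>.\<close>
  have pointwise: "?\<phi> z * ?h z \<le> (?\<phi> v * exp 3) * ?I z + ?h w * ?J z" for z
  proof -
    let ?g = "?\<phi> v * exp (- c * (z - v))"
    note compare = density_compare_exp_tangent[where z = z and v = v and c = c, folded w_def]
    consider "z < t" | "t \<le> z" "z < v" | "v \<le> z" "z \<le> w" | "w < z"
      by linarith
    then show ?thesis
    proof cases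
      case 1
      then show ?thesis using t by simp
    next
      case 2
      have "0 \<le> (z - v) * (z - w)"
        using 2 w by (intro mult_nonpos_nonpos) auto
      then have "?\<phi> z \<le> ?g" unfolding compare .
      then have "?\<phi> z * ?h z \<le> ?g * ?h z" by (intro mult_right_mono) auto
      then show ?thesis using 2 unfolding shift by (simp add: mult_ac)
    next
      case 3
      have "(z - v) * (z - w) \<le> 0"
        using 3 by (intro mult_nonneg_nonpos) auto
      then have "?g \<le> ?\<phi> z" unfolding compare .
      then have "(?\<phi> z - ?g) * ?h z \<le> (?\<phi> z - ?g) * ?h w"
        using 3 by (intro mult_left_mono h_mono) auto
      then show ?thesis using 3 t unfolding shift by (simp add: algebra_simps)
    next
      case 4
      have "0 \<le> (z - v) * (z - w)"
        using 4 w by (intro mult_nonneg_nonneg) auto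
      then have "?\<phi> z \<le> ?g" unfolding compare .
      then have "(?\<phi> z - ?g) * ?h z \<le> (?\<phi> z - ?g) * ?h w"
        using 4 by (intro mult_left_mono_neg h_mono) auto
      then show ?thesis using 4 w t unfolding shift by (simp add: algebra_simps)
    qed
  qed
  have J: "has_bochner_integral lborel ?J (?T - ?\<phi> v * (1 / c))"
    by (intro has_bochner_integral_diff has_bochner_integral_mult_right has_bochner_integral_std_normal_tail
        has_bochner_integral_exp_tail c)
  have R: "has_bochner_integral lborel (\<lambda>z. (?\<phi> v * exp 3) * ?I z + ?h w * ?J z)
      ((?\<phi> v * exp 3) * (6 / c ^ 4) + ?h w * (?T - ?\<phi> v * (1 / c)))"
    by (intro has_bochner_integral_add has_bochner_integral_mult_right J has_bochner_integral_cubic_exp c)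
  have meas: "?h \<in> borel_measurable borel" by measurable
  have "integrable lborel (\<lambda>z. ?\<phi> z * ?h z)"
    by (rule Bochner_Integration.integrable_bound[OF integrable.intros[OF R]])
       (use pointwise in \<open>auto intro!: AE_I2 intro: order_trans[OF _ abs_ge_self]\<close>)
  then have "has_bochner_integral lborel (\<lambda>z. ?\<phi> z * ?h z) (\<integral>z. ?h z \<partial>std_normal)"
    unfolding integral_std_normal[OF meas] by (rule has_bochner_integral_integrable)
  then have "(\<integral>z. ?h z \<partial>std_normal) \<le> (?\<phi> v * exp 3) * (6 / c ^ 4) + ?h w * (?T - ?\<phi> v * (1 / c))"
    by (rule has_bochner_integral_le[OF _ R pointwise])
  also have "?T - ?\<phi> v * (1 / c) = 0" using cT c by simp
  also have "(?\<phi> v * exp 3) * (6 / c ^ 4) + ?h w * 0 = 2 * exp 3 / 9 * (v - t) ^ 3 * ?T"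
    using c by (simp add: cT t_def power_divide field_simps eval_nat_numeral)
  finally show ?thesis .
qed

text \<open>
  The hypothesis \<open>3 \<le> v\<^sup>2\<close> together with \<open>c \<ge> v\<close> makes the truncation level \<open>v - 3 / c\<close> nonnegative, so that
  the two halves of \<open>cubic_excess\<close> are never both nonzero and, beyond \<open>t\<close>, the excess is just the cube of the distance to \<open>t\<close>.
\<close>
lemma cubic_excess_moment_bound:
  assumes "v > 0" "3 \<le> v\<^sup>2"
  obtains t where "0 \<le> t" "t < v"
    "(\<integral>z. cubic_excess t z \<partial>std_normal) \<le> 2 * exp 3 / 9 * (v - t) ^ 3 * (2 * std_normal_tail v)"
proof -
  define c where "c = std_normal_density v / std_normal_tail v"
  define t where "t = v - 3 / c"
  have T: "std_normal_tail v > 0" by (rule std_normal_tail_pos)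
  have vc: "v \<le> c"
    using Mills_upper_bound[of v] T by (simp add: c_def field_simps)
  then have c: "c > 0" using assms by simp
  have "3 \<le> v * c"
    using assms(2) mult_left_mono[OF vc, of v] assms(1) unfolding power2_eq_square by linarith
  then have t: "0 \<le> t" "t < v"
    using c by (auto simp: t_def field_simps)
  let ?p = "\<lambda>z::real. (max 0 (z - t)) ^ 3"
  have p: "integrable std_normal ?p"
  proof (rule Bochner_Integration.integrable_bound)
    show "integrable std_normal (\<lambda>z. \<bar>z\<bar> ^ 3)" by (rule integrable_std_normal_abs_power)
    show "AE z in std_normal. norm (?p z) \<le> norm (\<bar>z\<bar> ^ 3)"
      using t by (auto intro!: AE_I2 power_mono)
  qed simp
  have refl: "(\<integral>z. ?p (- z) \<partial>std_normal) = (\<integral>z. ?p z \<partial>std_normal)"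
    by (rule integral_std_normal_reflect) measurable
  have p': "integrable std_normal (\<lambda>z. ?p (- z))"
  proof -
    have "integrable (distr std_normal borel uminus) ?p"
      by (simp add: std_normal_uminus p)
    then show ?thesis by (subst (asm) integrable_distr_eq) auto
  qed
  have "(\<integral>z. cubic_excess t z \<partial>std_normal) = 2 * (\<integral>z. ?p z \<partial>std_normal)"
    unfolding cubic_excess_def using p p' refl by simp
  also have "\<dots> \<le> 2 * (2 * exp 3 / 9 * (v - t) ^ 3 * std_normal_tail v)"
    unfolding t_def c_def by (intro mult_left_mono truncated_cubic_moment_bound) auto
  finally show ?thesis
    using that[of t] t by (simp add: mult_ac)
qed

section \<open>Moderate deviations\<close>

text \<open>
  The derivative of \<open>w\<^sup>3 * exp (- w) / (1 + w)\<^sup>2\<close> has the sign of \<open>3 - w\<^sup>2\<close>, so on \<open>{1..3}\<close> the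
  function is smallest at an endpoint. There the claim reads \<open>81 * pi < 2 * exp 5\<close> and \<open>6 * pi < exp 3\<close>.
\<close>
lemma moderate_deviation_numeric:
  fixes w :: real
  assumes "1 \<le> w" "w \<le> 3"
  shows "1 < 8 * exp 6 / (81 * pi) * (w ^ 3 * exp (- w) / (1 + w)\<^sup>2)"
proof -
  let ?G = "\<lambda>w::real. w ^ 3 * exp (- w) / (1 + w)\<^sup>2"
  let ?G' = "\<lambda>w::real. w\<^sup>2 * exp (- w) * (3 - w\<^sup>2) / (1 + w) ^ 3"
  have G': "DERIV ?G w :> ?G' w" if "w > 0" for w
  proof -
    have N: "DERIV (\<lambda>w. w ^ 3 * exp (- w)) w :> 3 * w\<^sup>2 * exp (- w) - w ^ 3 * exp (- w)"
      by (auto intro!: derivative_eq_intros)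
    have D: "DERIV (\<lambda>w::real. (1 + w)\<^sup>2) w :> 2 * (1 + w)"
      by (auto intro!: derivative_eq_intros)
    have nz: "(1 + w)\<^sup>2 \<noteq> 0" using that by simp
    have "((3 * w\<^sup>2 * exp (- w) - w ^ 3 * exp (- w)) * (1 + w)\<^sup>2 - w ^ 3 * exp (- w) * (2 * (1 + w)))
          / ((1 + w)\<^sup>2 * (1 + w)\<^sup>2)
        = (w\<^sup>2 * exp (- w) * (3 - w\<^sup>2) * (1 + w)) / ((1 + w) ^ 3 * (1 + w))"
    proof (rule arg_cong2[where f = "(/)"])
      show "(3 * w\<^sup>2 * exp (- w) - w ^ 3 * exp (- w)) * (1 + w)\<^sup>2 - w ^ 3 * exp (- w) * (2 * (1 + w))
          = w\<^sup>2 * exp (- w) * (3 - w\<^sup>2) * (1 + w)"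
        by algebra
    qed (simp add: eval_nat_numeral)
    also have "\<dots> = ?G' w" using that by simp
    finally show ?thesis
      using DERIV_divide[OF N D nz] by simp
  qed
  have e: "exp 1 > (27/10 :: real)"
    using e_approx_32 by (simp add: abs_if split: if_split_asm)
  have pi: "pi < 32/10" using pi_approx by simp
  have e3: "exp 3 > (19683/1000 :: real)"
    using power_strict_mono[OF e, of 3] exp_of_nat_mult[of 3 "1::real"] by (simp add: eval_nat_numeral)
  have e5: "exp 5 > (143 :: real)"
    using power_strict_mono[OF e, of 5] exp_of_nat_mult[of 5 "1::real"] by (simp add: eval_nat_numeral)
  have at1: "1 < 8 * exp 6 / (81 * pi) * ?G 1"
  proof -
    have "8 * exp 6 / (81 * pi) * ?G 1 = 2 * exp 5 / (81 * pi)"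
      by (simp add: exp_minus field_simps exp_add[symmetric])
    then show ?thesis using e5 pi pi_gt_zero by (simp add: field_simps)
  qed
  have at3: "1 < 8 * exp 6 / (81 * pi) * ?G 3"
  proof -
    have "8 * exp 6 / (81 * pi) * ?G 3 = exp 3 / (6 * pi)"
      by (simp add: exp_minus field_simps exp_add[symmetric])
    then show ?thesis using e3 pi pi_gt_zero by (simp add: field_simps)
  qed
  have "?G 1 \<le> ?G w \<or> ?G 3 \<le> ?G w"
  proof (cases "w\<^sup>2 \<le> 3")
    case True
    have "?G 1 \<le> ?G w"
    proof (rule DERIV_nonneg_imp_nondecreasing[OF assms(1)])
      fix x assume x: "1 \<le> x" "x \<le> w"
      then have "x\<^sup>2 \<le> w\<^sup>2" by (intro power_mono) auto
      with True have "x\<^sup>2 \<le> 3" by linarith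
      with x have "0 \<le> ?G' x"
        by (intro divide_nonneg_pos mult_nonneg_nonneg) auto
      with G'[of x] x show "\<exists>y. DERIV ?G x :> y \<and> 0 \<le> y" by force
    qed
    then show ?thesis ..
  next
    case False
    have "?G 3 \<le> ?G w"
    proof (rule DERIV_nonpos_imp_nonincreasing[OF assms(2)])
      fix x assume x: "w \<le> x" "x \<le> 3"
      then have "w\<^sup>2 \<le> x\<^sup>2" using assms by (intro power_mono) auto
      with False have "3 \<le> x\<^sup>2" by linarith
      with x assms have "?G' x \<le> 0"
        by (intro divide_nonpos_pos mult_nonneg_nonpos) auto
      with G'[of x] x assms show "\<exists>y. DERIV ?G x :> y \<and> y \<le> 0" by force
    qed
    then show ?thesis ..
  qed
  moreover have "0 \<le> 8 * exp 6 / (81 * pi)" by simp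
  ultimately show ?thesis
    using at1 at3 by (meson less_le_trans mult_left_mono)
qed

text \<open>
  The left-hand side is the Chebyshev bound for a variable with second moment 1. After inserting the lower
  bound for the tail and squaring, the claim is the numerical inequality above with \<open>w = v\<^sup>2\<close>.
\<close>
lemma moderate_deviation_tail:
  assumes "1 \<le> v" "v\<^sup>2 \<le> 3"
  shows "1 / v\<^sup>2 < 2 * exp 3 / 9 * (2 * std_normal_tail v)"
proof -
  let ?A = "4 * exp 3 / 9 * (v / (1 + v\<^sup>2) * std_normal_density v)"
  have v: "v > 0" using assms by simp
  have "1 \<le> v\<^sup>2" using assms by (simp add: one_le_power)
  then have num: "1 < 8 * exp 6 / (81 * pi) * ((v\<^sup>2) ^ 3 * exp (- v\<^sup>2) / (1 + v\<^sup>2)\<^sup>2)"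
    using assms by (intro moderate_deviation_numeric)
  have "(v\<^sup>2 * ?A)\<^sup>2 = 8 * exp 6 / (81 * pi) * ((v\<^sup>2) ^ 3 * exp (- v\<^sup>2) / (1 + v\<^sup>2)\<^sup>2)"
  proof -
    have "(exp 3)\<^sup>2 = exp (6 :: real)" "(exp (- v\<^sup>2 / 2))\<^sup>2 = exp (- v\<^sup>2)"
      by (simp_all add: power2_eq_square exp_add[symmetric])
    moreover have "v\<^sup>2 * v\<^sup>2 * v\<^sup>2 = (v\<^sup>2) ^ 3" by (simp add: eval_nat_numeral)
    ultimately show ?thesis
      unfolding std_normal_density_def
      by (simp add: power_mult_distrib power_divide) (simp add: power2_eq_square eval_nat_numeral mult_ac)
  qed
  with num have "1\<^sup>2 < (v\<^sup>2 * ?A)\<^sup>2" by simp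
  then have "1 < v\<^sup>2 * ?A"
    by (rule power2_less_imp_less) (use v std_normal_density_pos[of v] in auto)
  then have "1 / v\<^sup>2 < ?A"
    using v by (simp add: field_simps)
  also have "?A \<le> 4 * exp 3 / 9 * std_normal_tail v"
    by (intro mult_left_mono Mills_lower_bound assms) auto
  finally show ?thesis by simp
qed

section \<open>Tails of signed sums of fixed vectors\<close>

text \<open>
  Gaussian domination is used for \<open>s\<^sup>2\<close> when \<open>1 \<le> v\<^sup>2 \<le> 3\<close> and for \<open>cubic_excess t\<close> when \<open>v\<^sup>2 > 3\<close>. In
  the latter case the moment bound is not strict; strictness comes from Markov's inequality,
  because a sum longer than \<open>v\<close> has an excess strictly above \<open>(v - t)\<^sup>3\<close>.
\<close>
lemma Rademacher_tail_unit:
  fixes x :: "'i \<Rightarrow> 'a::real_inner"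
  assumes "finite I" and unit: "(\<Sum>i\<in>I. (norm (x i))\<^sup>2) = 1" and "v \<ge> 0"
  shows "real (card {A \<in> Pow I. v < norm (signed_sum x I A)})
       < 2 ^ card I * (2 * exp 3 / 9 * (2 * std_normal_tail v))"
proof -
  let ?S = "\<lambda>A. norm (signed_sum x I A)" and ?E = "{A \<in> Pow I. v < norm (signed_sum x I A)}"
  have fin: "finite (Pow I)" using assms(1) by simp
  have Markov: "real (card ?E) * b \<le> (\<Sum>A\<in>Pow I. f (?S A))"
    if "\<And>A. A \<in> Pow I \<Longrightarrow> 0 \<le> f (?S A)" "\<And>A. A \<in> ?E \<Longrightarrow> b \<le> f (?S A)" for f :: "real \<Rightarrow> real" and b
  proof -
    have "real (card ?E) * b \<le> (\<Sum>A\<in>?E. f (?S A))"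
      using sum_mono[of ?E "\<lambda>_. b" "\<lambda>A. f (?S A)"] that(2) by simp
    also have "\<dots> \<le> (\<Sum>A\<in>Pow I. f (?S A))"
      by (rule sum_mono2) (use fin that(1) in auto)
    finally show ?thesis .
  qed
  consider "v \<le> 1" | "1 \<le> v" "v\<^sup>2 \<le> 3" | "v > 1" "3 < v\<^sup>2"
    by linarith
  then show ?thesis
  proof cases
    case 1
    have "real (card ?E) \<le> 2 ^ card I"
      using card_mono[OF fin, of ?E] assms(1) by (auto simp: card_Pow simp flip: of_nat_power)
    also have "\<dots> < 2 ^ card I * (2 * exp 3 / 9 * (2 * std_normal_tail 1))"
      using moderate_deviation_tail[of 1] by simp
    also have "\<dots> \<le> 2 ^ card I * (2 * exp 3 / 9 * (2 * std_normal_tail v))"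
      using std_normal_tail_antimono[OF 1] by (intro mult_left_mono) auto
    finally show ?thesis .
  next
    case 2
    have "real (card ?E) * v\<^sup>2 \<le> (\<Sum>A\<in>Pow I. (?S A)\<^sup>2)"
      using 2 by (intro Markov power_mono) auto
    also have "\<dots> \<le> 2 ^ card I * (\<integral>z. (sqrt (\<Sum>i\<in>I. (norm (x i))\<^sup>2) * z)\<^sup>2 \<partial>std_normal)"
      by (rule signed_sum_gauss_domination[OF assms(1) spread_convex_square cubic_growth_square])
    also have "\<dots> = 2 ^ card I"
      by (simp add: unit std_normal_second_moment)
    finally have "real (card ?E) \<le> 2 ^ card I * (1 / v\<^sup>2)"
      using 2 by (simp add: field_simps)
    also have "\<dots> < 2 ^ card I * (2 * exp 3 / 9 * (2 * std_normal_tail v))"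
      by (intro mult_strict_left_mono moderate_deviation_tail 2) simp
    finally show ?thesis .
  next
    case 3
    show ?thesis
    proof (cases "?E = {}")
      case True
      then show ?thesis
        using std_normal_tail_pos[of v] by (simp only: card.empty) simp
    next
      case False
      obtain t where t: "0 \<le> t" "t < v"
        "(\<integral>z. cubic_excess t z \<partial>std_normal) \<le> 2 * exp 3 / 9 * (v - t) ^ 3 * (2 * std_normal_tail v)"
        using cubic_excess_moment_bound[of v] 3 by auto
      have nonneg: "0 \<le> cubic_excess t s" for s
        by (simp add: cubic_excess_def)
      have excess: "(v - t) ^ 3 < cubic_excess t s" if "v < s" for s
      proof -
        have "(v - t) ^ 3 < (s - t) ^ 3"
          using that t by (intro power_strict_mono) auto
        then show ?thesis
          using that t by (simp add: cubic_excess_def)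
      qed
      have finE: "finite ?E" by (rule finite_subset[OF _ fin]) auto
      have "real (card ?E) * (v - t) ^ 3 = (\<Sum>A\<in>?E. (v - t) ^ 3)" by simp
      also have "\<dots> < (\<Sum>A\<in>?E. cubic_excess t (?S A))"
        by (rule sum_strict_mono[OF finE False]) (auto intro: excess)
      also have "\<dots> \<le> (\<Sum>A\<in>Pow I. cubic_excess t (?S A))"
        by (rule sum_mono2) (use fin nonneg in auto)
      also have "\<dots> \<le> 2 ^ card I * (\<integral>z. cubic_excess t (sqrt (\<Sum>i\<in>I. (norm (x i))\<^sup>2) * z) \<partial>std_normal)"
        by (rule signed_sum_gauss_domination[OF assms(1) spread_convex_cubic_excess
              cubic_growth_cubic_excess[OF t(1)]])
      also have "\<dots> = 2 ^ card I * (\<integral>z. cubic_excess t z \<partial>std_normal)"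
        by (simp add: unit)
      also have "\<dots> \<le> 2 ^ card I * (2 * exp 3 / 9 * (v - t) ^ 3 * (2 * std_normal_tail v))"
        by (intro mult_left_mono t) auto
      also have "\<dots> = (2 ^ card I * (2 * exp 3 / 9 * (2 * std_normal_tail v))) * (v - t) ^ 3"
        by simp
      finally show ?thesis
        by (rule mult_right_less_imp_less) (use t in auto)
    qed
  qed
qed

theorem Rademacher_tail:
  fixes x :: "'i \<Rightarrow> 'a::real_inner"
  assumes "finite I" and a: "sqrt (\<Sum>i\<in>I. (norm (x i))\<^sup>2) > 0" and "u \<ge> 0"
  shows "real (card {A \<in> Pow I. u < norm (signed_sum x I A)})
       < 2 ^ card I * (2 * exp 3 / 9 * measure std_normal {z. u < sqrt (\<Sum>i\<in>I. (norm (x i))\<^sup>2) * \<bar>z\<bar>})"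
proof -
  let ?a = "sqrt (\<Sum>i\<in>I. (norm (x i))\<^sup>2)"
  let ?y = "\<lambda>i. (1 / ?a) *\<^sub>R x i"
  have "(\<Sum>i\<in>I. (norm (?y i))\<^sup>2) = (\<Sum>i\<in>I. (norm (x i))\<^sup>2 / ?a\<^sup>2)"
    using a by (simp add: power_mult_distrib power_divide)
  also have "\<dots> = 1"
    using a by (simp add: sum_divide_distrib[symmetric] sum_nonneg)
  finally have unit: "(\<Sum>i\<in>I. (norm (?y i))\<^sup>2) = 1" .
  have "signed_sum ?y I A = (1 / ?a) *\<^sub>R signed_sum x I A" for A
    unfolding signed_sum_def scaleR_sum_right by (intro sum.cong) auto
  then have "u / ?a < norm (signed_sum ?y I A) \<longleftrightarrow> u < norm (signed_sum x I A)" for A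
    using a by (simp add: divide_less_cancel divide_strict_right_mono)
  moreover have "{z. u < ?a * \<bar>z\<bar>} = {z. u / ?a < \<bar>z\<bar>}"
    using a by (auto simp: field_simps)
  moreover have "u / ?a \<ge> 0" using a assms by simp
  ultimately show ?thesis
    using Rademacher_tail_unit[OF assms(1) unit, of "u / ?a"]
    by (simp add: measure_std_normal_two_sided)
qed

section \<open>Symmetrization\<close>

text \<open>
  Negating some members of an independent family of symmetric vectors leaves the joint law, a product of
  the marginals, unchanged.
\<close>
lemma (in prob_space) distr_signed_sum_eq:
  fixes X :: "'i \<Rightarrow> 'a \<Rightarrow> 'b::euclidean_space"
  assumes I: "finite I" "I \<noteq> {}" and indep: "indep_vars (\<lambda>_. borel) X I"
    and sym: "\<And>i. i \<in> I \<Longrightarrow> distr M borel (\<lambda>\<omega>. - X i \<omega>) = distr M borel (X i)"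
  shows "distr M borel (\<lambda>\<omega>. signed_sum (\<lambda>i. X i \<omega>) I A) = distr M borel (\<lambda>\<omega>. \<Sum>i\<in>I. X i \<omega>)"
proof -
  let ?Y = "\<lambda>i \<omega>. if i \<in> A then - X i \<omega> else X i \<omega>"
  have X [measurable]: "random_variable borel (X i)" if "i \<in> I" for i
    using indep that by (auto simp: indep_vars_def)
  have "indep_vars (\<lambda>_. borel) (\<lambda>i \<omega>. (if i \<in> A then uminus else (\<lambda>x. x)) (X i \<omega>)) I"
    by (rule indep_vars_compose2[OF indep]) auto
  then have Y: "indep_vars (\<lambda>_. borel) ?Y I"
    by (rule indep_vars_cong[THEN iffD1, rotated -1]) auto
  have "distr M (\<Pi>\<^sub>M i\<in>I. borel) (\<lambda>\<omega>. \<lambda>i\<in>I. ?Y i \<omega>) = (\<Pi>\<^sub>M i\<in>I. distr M borel (?Y i))"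
    by (rule indep_vars_iff_distr_eq_PiM'[THEN iffD1, OF I(2) _ Y]) auto
  also have "\<dots> = (\<Pi>\<^sub>M i\<in>I. distr M borel (X i))"
  proof (intro PiM_cong refl)
    fix i assume "i \<in> I"
    then show "distr M borel (?Y i) = distr M borel (X i)"
      using sym[of i] by (cases "i \<in> A") simp_all
  qed
  also have "\<dots> = distr M (\<Pi>\<^sub>M i\<in>I. borel) (\<lambda>\<omega>. \<lambda>i\<in>I. X i \<omega>)"
    by (rule indep_vars_iff_distr_eq_PiM'[THEN iffD1, OF I(2) _ indep, symmetric]) auto
  finally have eq: "distr M (\<Pi>\<^sub>M i\<in>I. borel) (\<lambda>\<omega>. \<lambda>i\<in>I. ?Y i \<omega>) = distr M (\<Pi>\<^sub>M i\<in>I. borel) (\<lambda>\<omega>. \<lambda>i\<in>I. X i \<omega>)" .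
  have push: "distr M borel (\<lambda>\<omega>. \<Sum>i\<in>I. V i \<omega>)
      = distr (distr M (\<Pi>\<^sub>M i\<in>I. borel) (\<lambda>\<omega>. \<lambda>i\<in>I. V i \<omega>)) borel (\<lambda>x. \<Sum>i\<in>I. x i)"
    if [measurable]: "\<And>i. i \<in> I \<Longrightarrow> random_variable borel (V i)" for V :: "'i \<Rightarrow> 'a \<Rightarrow> 'b"
    by (subst distr_distr) (auto simp: comp_def)
  have "distr M borel (\<lambda>\<omega>. \<Sum>i\<in>I. ?Y i \<omega>) = distr M borel (\<lambda>\<omega>. \<Sum>i\<in>I. X i \<omega>)"
    by (subst (1 2) push) (auto simp: eq)
  then show ?thesis
    by (simp add: signed_sum_def)
qed

text \<open>
  Each sign pattern contributes the same probability, so the expected number of patterns with a long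
  signed sum is \<open>2 ^ card I\<close> times the probability that the plain sum is long.
\<close>
lemma (in prob_space) expectation_signed_sum_count:
  fixes X :: "'i \<Rightarrow> 'a \<Rightarrow> 'b::euclidean_space" and u :: real
  assumes I: "finite I" "I \<noteq> {}" and indep: "indep_vars (\<lambda>_. borel) X I"
    and sym: "\<And>i. i \<in> I \<Longrightarrow> distr M borel (\<lambda>\<omega>. - X i \<omega>) = distr M borel (X i)"
  defines "N \<equiv> \<lambda>\<omega>. real (card {A \<in> Pow I. u < norm (signed_sum (\<lambda>i. X i \<omega>) I A)})"
  shows "integrable M N" and "expectation N = 2 ^ card I * \<P>(\<omega> in M. u < norm (\<Sum>i\<in>I. X i \<omega>))"
proof -
  have X [measurable]: "random_variable borel (X i)" if "i \<in> I" for i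
    using indep that by (auto simp: indep_vars_def)
  let ?E = "\<lambda>A. {\<omega> \<in> space M. u < norm (signed_sum (\<lambda>i. X i \<omega>) I A)}"
  have S [measurable]: "random_variable borel (\<lambda>\<omega>. signed_sum (\<lambda>i. X i \<omega>) I A)" for A
    unfolding signed_sum_def by (intro borel_measurable_sum) (auto split: if_split)
  have N: "N \<omega> = (\<Sum>A\<in>Pow I. indicator (?E A) \<omega>)" if "\<omega> \<in> space M" for \<omega>
    using I that by (simp add: N_def indicator_def if_distrib sum.If_cases Int_def)
  have int: "integrable M (\<lambda>\<omega>. \<Sum>A\<in>Pow I. indicator (?E A) \<omega> :: real)"
    by (intro Bochner_Integration.integrable_sum integrable_real_indicator) (auto simp: emeasure_eq_measure)
  then show "integrable M N"
    by (rule Bochner_Integration.integrable_cong[THEN iffD1, rotated -1]) (use N in auto)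
  have law: "prob (?E A) = \<P>(\<omega> in M. u < norm (\<Sum>i\<in>I. X i \<omega>))" for A
  proof -
    have flip: "distr M borel (\<lambda>\<omega>. signed_sum (\<lambda>i. X i \<omega>) I A) = distr M borel (\<lambda>\<omega>. \<Sum>i\<in>I. X i \<omega>)"
      by (rule distr_signed_sum_eq[OF I indep sym])
    have "prob (?E A) = measure (distr M borel (\<lambda>\<omega>. signed_sum (\<lambda>i. X i \<omega>) I A)) {x. u < norm x}"
      by (subst measure_distr) (auto intro!: arg_cong[where f = prob])
    also have "\<dots> = \<P>(\<omega> in M. u < norm (\<Sum>i\<in>I. X i \<omega>))"
      unfolding flip by (subst measure_distr) (auto intro!: arg_cong[where f = prob])
    finally show ?thesis .
  qed
  have "expectation N = expectation (\<lambda>\<omega>. \<Sum>A\<in>Pow I. indicator (?E A) \<omega>)"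
    by (rule Bochner_Integration.integral_cong) (use N in auto)
  also have "\<dots> = (\<Sum>A\<in>Pow I. prob (?E A))"
    by (subst Bochner_Integration.integral_sum)
       (auto simp: emeasure_eq_measure intro!: sum.cong arg_cong[where f = prob])
  also have "\<dots> = 2 ^ card I * \<P>(\<omega> in M. u < norm (\<Sum>i\<in>I. X i \<omega>))"
    using I by (simp add: law card_Pow)
  finally show "expectation N = 2 ^ card I * \<P>(\<omega> in M. u < norm (\<Sum>i\<in>I. X i \<omega>))" .
qed

text \<open>
  Fubini's theorem for the product law of \<open>(a, \<zeta>)\<close>; it brings the pointwise bound for fixed vectors
  back to a probability.
\<close>
lemma (in prob_space) scaled_std_normal_tail_mixture:
  fixes a \<zeta> :: "'a \<Rightarrow> real" and u :: real
  assumes indep: "indep_var borel a borel \<zeta>" and \<zeta>: "distributed M lborel \<zeta> std_normal_density"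
  defines "G \<equiv> \<lambda>\<omega>. measure std_normal {z. u < a \<omega> * \<bar>z\<bar>}"
  shows "integrable M G" and "expectation G = \<P>(\<omega> in M. u < a \<omega> * \<bar>\<zeta> \<omega>\<bar>)"
proof -
  have a [measurable]: "random_variable borel a" and [measurable]: "random_variable borel \<zeta>"
    using indep by (auto simp: indep_var_rv1 indep_var_rv2)
  let ?D = "distr M borel a"
  have "distr M borel \<zeta> = distr M lborel \<zeta>" by (rule distr_cong) auto
  also have "\<dots> = std_normal" using \<zeta> by (simp add: distributed_def std_normal_def)
  finally have law: "distr M borel \<zeta> = std_normal" .
  interpret D: prob_space ?D by (rule prob_space_distr) simp
  interpret P: pair_prob_space ?D std_normal ..
  let ?B = "{(s, z). u < s * \<bar>z\<bar>} :: (real \<times> real) set"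
  have "{p \<in> space (borel \<Otimes>\<^sub>M borel). u < fst p * \<bar>snd p :: real\<bar>} \<in> sets (borel \<Otimes>\<^sub>M borel)"
    by measurable
  then have B [measurable]: "?B \<in> sets (borel \<Otimes>\<^sub>M borel)"
    by (simp add: space_pair_measure case_prod_beta')
  define g where "g s = (\<integral>z. indicator ?B (s, z) \<partial>std_normal :: real)" for s
  have g: "g s = measure std_normal {z. u < s * \<bar>z\<bar>}" for s
  proof -
    have "g s = (\<integral>z. indicator {z. u < s * \<bar>z\<bar>} z \<partial>std_normal)"
      unfolding g_def by (intro Bochner_Integration.integral_cong) (auto simp: indicator_def)
    then show ?thesis by simp
  qed
  have [measurable]: "g \<in> borel_measurable borel"
    unfolding g_def by measurable
  have "integrable M (\<lambda>\<omega>. g (a \<omega>))"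
    by (rule integrable_const_bound[of _ 1]) (auto simp: g)
  then show "integrable M G" by (simp add: G_def g)
  have "expectation G = (\<integral>s. g s \<partial>?D)"
    by (subst integral_distr) (auto simp: G_def g)
  also have "\<dots> = (\<integral>p. indicator ?B p \<partial>(?D \<Otimes>\<^sub>M std_normal))"
    unfolding g_def
    by (rule P.integral_fst') (auto simp: P.emeasure_eq_measure intro!: integrable_real_indicator)
  also have "\<dots> = measure (?D \<Otimes>\<^sub>M std_normal) ?B"
    by simp
  also have "?D \<Otimes>\<^sub>M std_normal = distr M (borel \<Otimes>\<^sub>M borel) (\<lambda>\<omega>. (a \<omega>, \<zeta> \<omega>))"
    using indep unfolding indep_var_distribution_eq law[symmetric] by simp
  also have "measure \<dots> ?B = \<P>(\<omega> in M. u < a \<omega> * \<bar>\<zeta> \<omega>\<bar>)"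
    by (subst measure_distr) (auto intro!: arg_cong[where f = prob])
  finally show "expectation G = \<P>(\<omega> in M. u < a \<omega> * \<bar>\<zeta> \<omega>\<bar>)" .
qed

text \<open>
  For \<open>u \<ge> 0\<close> the pointwise bound is strict wherever the vectors \<open>X i \<omega>\<close> are not all zero and both sides
  vanish elsewhere. Nondegeneracy gives the first event positive probability, which keeps the inequality
  strict after integration. For \<open>u < 0\<close> both probabilities are 1 and the constant exceeds 1.
\<close>
theorem corollary1:
  fixes M :: "'w measure"
    and X :: "nat \<Rightarrow> 'w \<Rightarrow> real ^ 'd"
    and Z :: "'w \<Rightarrow> real ^ 'd"
    and n :: nat
    and u :: real
  assumes "prob_space M"
    and "n \<ge> 1"
    and "standard_normal_vector M Z"
    and "\<And>i. i \<in> {1..n} \<Longrightarrow> spherically_invariant M (X i)"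
    and "prob_space.indep_vars M (\<lambda>_. borel) (X(0 := Z)) {0..n}"
    and nondegenerate: "u \<ge> 0 \<Longrightarrow> \<exists>i\<in>{1..n}. \<not> (AE \<omega> in M. X i \<omega> = 0)"
  shows "\<P>(\<omega> in M. norm (\<Sum>i=1..n. X i \<omega>) > u)
       < 2 * exp 3 / 9 * \<P>(\<omega> in M. sqrt (\<Sum>i=1..n. (norm (X i \<omega>))\<^sup>2) * norm (Z \<omega>) > u)"
proof -
  interpret prob_space M by fact
  let ?I = "{1..n}"
  let ?a = "\<lambda>\<omega>. sqrt (\<Sum>i\<in>?I. (norm (X i \<omega>))\<^sup>2)"
  have a_nonneg: "0 \<le> ?a \<omega>" for \<omega>
    by (simp add: sum_nonneg)
  show ?thesis
  proof (cases "u < 0")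
    case True
    have norm: "u < norm x" for x :: "real ^ 'd"
      using True by (rule less_le_trans) simp
    have "u < ?a \<omega> * norm (Z \<omega>)" for \<omega>
      using True by (rule less_le_trans) (intro mult_nonneg_nonneg a_nonneg norm_ge_zero)
    moreover have "1 < 2 * exp 3 / (9 :: real)"
    proof -
      \<comment> \<open>The tangent bound for \<open>exp\<close> at \<open>3 / 2\<close> gives \<open>exp 3 \<ge> 25 / 4\<close>, while \<open>exp 3 > 9 / 2\<close> is needed.\<close>
      have "(1 + 3 / 2 :: real) ^ 2 \<le> exp (3 / 2) ^ 2"
        by (intro power_mono exp_ge_add_one_self) auto
      also have "\<dots> = exp 3" by (simp add: power2_eq_square exp_add[symmetric])
      finally show ?thesis by (simp add: power2_eq_square)
    qed
    ultimately show ?thesis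
      using norm prob_space by simp
  next
    case False
    then have u: "u \<ge> 0" by simp
    obtain k :: 'd where True by simp
    let ?\<zeta> = "\<lambda>\<omega>. Z \<omega> $ k"
    have "?I \<noteq> {}" using assms(2) by simp
    note fam = assms(5)
    have indep_X: "indep_vars (\<lambda>_. borel) X ?I"
      by (rule indep_vars_cong[THEN iffD1, OF _ _ _ indep_vars_subset[OF fam]]) auto
    have sym: "distr M borel (\<lambda>\<omega>. - X i \<omega>) = distr M borel (X i)" if "i \<in> ?I" for i
    proof -
      have "orthogonal_transformation (\<lambda>x :: real ^ 'd. - x)"
        by (simp add: orthogonal_transformation_neg orthogonal_transformation_id)
      then show ?thesis
        using assms(4)[OF that] unfolding spherically_invariant_def by blast
    qed
    have X [measurable]: "random_variable borel (X i)" if "i \<in> ?I" for i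
      using assms(4)[OF that] by (simp add: spherically_invariant_def)
    have Z: "random_variable borel Z"
    proof -
      have "\<forall>i\<in>{0..n}. random_variable borel ((X(0 := Z)) i)"
        using fam unfolding indep_vars_def by (rule conjunct1)
      then show ?thesis by (auto dest: bspec[of _ _ 0])
    qed
    have \<zeta>: "distributed M lborel ?\<zeta> std_normal_density"
      using assms(3) by (simp add: standard_normal_vector_def)
    have "indep_var borel
        ((\<lambda>x. sqrt (\<Sum>i\<in>?I. (norm (x i))\<^sup>2)) \<circ> (\<lambda>\<omega>. restrict (\<lambda>i. (X(0 := Z)) i \<omega>) ?I)) borel
        ((\<lambda>x. x 0 $ k) \<circ> (\<lambda>\<omega>. restrict (\<lambda>i. (X(0 := Z)) i \<omega>) {0}))"
    proof (rule indep_var_compose[OF indep_var_restrict[OF fam]])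
      have "(\<lambda>x :: real ^ 'd. x $ k) \<in> borel_measurable borel"
        by (intro borel_measurable_continuous_onI continuous_intros)
      moreover have "(\<lambda>x. x 0) \<in> measurable (\<Pi>\<^sub>M i\<in>{0::nat}. borel) (borel :: (real ^ 'd) measure)"
        by (rule measurable_component_singleton) simp
      ultimately show "(\<lambda>x :: nat \<Rightarrow> real ^ 'd. x 0 $ k) \<in> borel_measurable (\<Pi>\<^sub>M i\<in>{0::nat}. borel)"
        by (rule measurable_compose[rotated])
    qed auto
    also have "(\<lambda>x. sqrt (\<Sum>i\<in>?I. (norm (x i))\<^sup>2)) \<circ> (\<lambda>\<omega>. restrict (\<lambda>i. (X(0 := Z)) i \<omega>) ?I) = ?a"
      by (auto simp: fun_eq_iff intro!: sum.cong)
    also have "(\<lambda>x. x 0 $ k) \<circ> (\<lambda>\<omega>. restrict (\<lambda>i. (X(0 := Z)) i \<omega>) {0}) = ?\<zeta>"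
      by (auto simp: fun_eq_iff)
    finally have indep_a: "indep_var borel ?a borel ?\<zeta>" .
    let ?N = "\<lambda>\<omega>. real (card {A \<in> Pow ?I. u < norm (signed_sum (\<lambda>i. X i \<omega>) ?I A)})"
    let ?G = "\<lambda>\<omega>. measure std_normal {z. u < ?a \<omega> * \<bar>z\<bar>}"
    let ?K = "\<lambda>\<omega>. 2 ^ card ?I * (2 * exp 3 / 9 * ?G \<omega>)"
    note N = expectation_signed_sum_count[OF _ \<open>?I \<noteq> {}\<close> indep_X sym, of u, simplified]
    note G = scaled_std_normal_tail_mixture[OF indep_a \<zeta>, of u]
    let ?pos = "{\<omega> \<in> space M. 0 < ?a \<omega>}"
    have strict: "?N \<omega> < ?K \<omega>" if "0 < ?a \<omega>" for \<omega>
      by (rule Rademacher_tail) (use that u in auto)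
    have degenerate: "?N \<omega> = 0" if "\<not> 0 < ?a \<omega>" for \<omega>
    proof -
      have "?a \<omega> = 0" using that a_nonneg[of \<omega>] by linarith
      then have "\<forall>i\<in>?I. X i \<omega> = 0" by (simp add: sum_nonneg_eq_0_iff)
      then have "signed_sum (\<lambda>i. X i \<omega>) ?I A = 0" for A
        unfolding signed_sum_def by (intro sum.neutral) auto
      then show ?thesis using u by simp
    qed
    have pos: "emeasure M ?pos \<noteq> 0"
    proof
      assume "emeasure M ?pos = 0"
      then have "AE \<omega> in M. \<not> 0 < ?a \<omega>"
        by (subst AE_iff_measurable[of ?pos]) auto
      then have zero: "AE \<omega> in M. \<forall>i\<in>?I. X i \<omega> = 0"
      proof eventually_elim
        case (elim \<omega>)
        then have "?a \<omega> = 0" using a_nonneg[of \<omega>] by linarith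
        then show ?case by (simp add: sum_nonneg_eq_0_iff)
      qed
      obtain i where "i \<in> ?I" "\<not> (AE \<omega> in M. X i \<omega> = 0)"
        using nondegenerate[OF u] by blast
      moreover have "AE \<omega> in M. X i \<omega> = 0"
        using zero by eventually_elim (use \<open>i \<in> ?I\<close> in blast)
      ultimately show False by blast
    qed
    have "expectation ?N < expectation ?K"
    proof (rule integral_less_AE[where A = ?pos])
      show "integrable M ?N" using N(1) by simp
      show "integrable M ?K" by (intro integrable_mult_right G(1))
      show "AE \<omega> in M. \<omega> \<in> ?pos \<longrightarrow> ?N \<omega> \<noteq> ?K \<omega>"
        using strict by (intro AE_I2) (auto dest: less_imp_neq)
      show "AE \<omega> in M. ?N \<omega> \<le> ?K \<omega>"
      proof (rule AE_I2)
        fix \<omega>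
        show "?N \<omega> \<le> ?K \<omega>"
        proof (cases "0 < ?a \<omega>")
          case True
          then show ?thesis by (rule less_imp_le[OF strict])
        next
          case False
          show ?thesis unfolding degenerate[OF False] by simp
        qed
      qed
    qed (use pos in auto)
    then have "2 ^ card ?I * \<P>(\<omega> in M. u < norm (\<Sum>i\<in>?I. X i \<omega>))
        < 2 ^ card ?I * (2 * exp 3 / 9 * \<P>(\<omega> in M. u < ?a \<omega> * \<bar>?\<zeta> \<omega>\<bar>))"
      using N(2) G(2) by simp
    then have "\<P>(\<omega> in M. u < norm (\<Sum>i\<in>?I. X i \<omega>)) < 2 * exp 3 / 9 * \<P>(\<omega> in M. u < ?a \<omega> * \<bar>?\<zeta> \<omega>\<bar>)"
      by simp
    also have "\<dots> \<le> 2 * exp 3 / 9 * \<P>(\<omega> in M. u < ?a \<omega> * norm (Z \<omega>))"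
    proof (intro mult_left_mono finite_measure_mono)
      have "?a \<omega> * \<bar>?\<zeta> \<omega>\<bar> \<le> ?a \<omega> * norm (Z \<omega>)" for \<omega>
        by (intro mult_left_mono component_le_norm_cart a_nonneg)
      then show "{\<omega> \<in> space M. u < ?a \<omega> * \<bar>?\<zeta> \<omega>\<bar>} \<subseteq> {\<omega> \<in> space M. u < ?a \<omega> * norm (Z \<omega>)}"
        by (auto intro: less_le_trans)
      show "{\<omega> \<in> space M. u < ?a \<omega> * norm (Z \<omega>)} \<in> events"
        using Z by measurable
    qed simp
    finally show ?thesis .
  qed
qed

end
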